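(* Let $G$ be a profinite subgroup of $S_\infty$ with orbit independence. Then the existential theory of $G$ (the set of existential first-order sentences in the language of groups true in $G$) is $\Sigma^0_1$ relative to $\deg(T_G)$.
   Context: $S_\infty$ is the group of all permutations of $\mathbb{N}$, with the topology of pointwise convergence; its profinite subgroups are exactly the closed subgroups all of whose orbits $\mathrm{orb}_G(n)=\{g(n):g\in G\}$ are finite. For a subgroup $G\le S_\infty$, $T_G\subseteq\mathbb{N}^{<\omega}$ is the tree of all strings of the form $g(0)g^{-1}(0)g(1)g^{-1}(1)\cdots g(n)g^{-1}(n)$ with $g\in G$, $n\in\mathbb{N}$, ordered by initial segment. $\deg(T_G)$ is the Turing join of the degree of the set $T_G$ (under a fixed computable coding of $\mathbb{N}^{<\omega}$ in which the immediate-predecessor relation is decidable) and the degree of the branching function $Br:T_G\to\mathbb{N}\cup\{\infty\}$, $Br(\tau)=$ number of immediate successors of $\tau$ in $T_G$. The orbits of a profinite $G$ are enumerated as $O_{G,0}=\mathrm{orb}_G(0)$ and $O_{G,n+1}=$ the orbit of the least natural number not in any $O_{G,m}$, $m\le n$. $H_k=\{g\restriction O_{G,k}:g\in G\}$ (a finite group). $G$ has orbit independence if $G$ is isomorphic to the Cartesian product $\prod_{k\in\mathbb{N}}H_k$. *)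

theory Defs
  imports
    "HOL-Analysis.T1_Spaces"
    "HOL-Algebra.Bij"
    "HOL-Algebra.Product_Groups"
    "HOL-Library.Nat_Bijection"
    "HOL-Library.Extended_Nat"
    "HOL-Library.Sublist"
begin

section \<open>Relative computability\<close>

text \<open>
  The total functions \<open>nat \<Rightarrow> nat\<close> computable relative to \<open>A\<close>. Functions of several arguments
  are unary functions of a (Cantor-)coded tuple, and minimization is restricted to regular
  functions; by Kleene's normal form theorem this yields exactly the total functions among the
  partial \<open>A\<close>-recursive ones.
\<close>

inductive recursive_in :: "nat set \<Rightarrow> (nat \<Rightarrow> nat) \<Rightarrow> bool" for A :: "nat set" where
  query: "recursive_in A (\<lambda>x. of_bool (x \<in> A))"
| zero: "recursive_in A (\<lambda>x. 0)"
| succ: "recursive_in A Suc"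
| left: "recursive_in A (\<lambda>x. fst (prod_decode x))"
| right: "recursive_in A (\<lambda>x. snd (prod_decode x))"
| pair: "recursive_in A f \<Longrightarrow> recursive_in A g \<Longrightarrow>
    recursive_in A (\<lambda>x. prod_encode (f x, g x))"
| comp: "recursive_in A f \<Longrightarrow> recursive_in A g \<Longrightarrow> recursive_in A (\<lambda>x. f (g x))"
| prec: "recursive_in A f \<Longrightarrow> recursive_in A g \<Longrightarrow>
    recursive_in A (\<lambda>x. case prod_decode x of (a, n) \<Rightarrow>
      rec_nat (f a) (\<lambda>i r. g (prod_encode (a, prod_encode (i, r)))) n)"
| mu: "recursive_in A f \<Longrightarrow> (\<And>a. \<exists>n. f (prod_encode (a, n)) = 0) \<Longrightarrow>
    recursive_in A (\<lambda>a. LEAST n. f (prod_encode (a, n)) = 0)"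

definition turing_reducible :: "nat set \<Rightarrow> nat set \<Rightarrow> bool" (infix \<open>\<le>\<^sub>T\<close> 50) where
  "B \<le>\<^sub>T A \<longleftrightarrow> recursive_in A (\<lambda>x. of_bool (x \<in> B))"

definition turing_join :: "nat set \<Rightarrow> nat set \<Rightarrow> nat set" where
  "turing_join A B = {2 * n | n. n \<in> A} \<union> {2 * n + 1 | n. n \<in> B}"

definition Sigma01_in :: "nat set \<Rightarrow> nat set \<Rightarrow> bool" where
  "Sigma01_in A S \<longleftrightarrow> (\<exists>R. R \<le>\<^sub>T A \<and> S = {n. \<exists>m. prod_encode (n, m) \<in> R})"

lemma recursive_in_mono:
  assumes "recursive_in A f" and "A \<le>\<^sub>T B"
  shows "recursive_in B f"
  using assms(1)
  by induction (use assms(2) in \<open>simp_all add: turing_reducible_def recursive_in.intros\<close>)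

lemma turing_reducible_trans: "C \<le>\<^sub>T A \<Longrightarrow> A \<le>\<^sub>T B \<Longrightarrow> C \<le>\<^sub>T B"
  using recursive_in_mono unfolding turing_reducible_def by blast

text \<open>Hence \<open>Sigma01_in\<close> depends only on the Turing degree of its first argument.\<close>

lemma Sigma01_in_mono: "Sigma01_in A S \<Longrightarrow> A \<le>\<^sub>T B \<Longrightarrow> Sigma01_in B S"
  by (auto simp: Sigma01_in_def intro: turing_reducible_trans)


section \<open>Subgroups of the permutation group of the natural numbers\<close>

abbreviation S_inf :: "(nat \<Rightarrow> nat) monoid" where
  "S_inf \<equiv> BijGroup UNIV"

abbreviation perm_group :: "(nat \<Rightarrow> nat) set \<Rightarrow> (nat \<Rightarrow> nat) monoid" where
  "perm_group G \<equiv> S_inf\<lparr>carrier := G\<rparr>"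

definition pointwise_topology :: "(nat \<Rightarrow> nat) topology" where
  "pointwise_topology = product_topology (\<lambda>_. discrete_topology UNIV) UNIV"

definition orb :: "(nat \<Rightarrow> nat) set \<Rightarrow> nat \<Rightarrow> nat set" where
  "orb G n = {g n | g. g \<in> G}"

definition profinite_subgroup :: "(nat \<Rightarrow> nat) set \<Rightarrow> bool" where
  "profinite_subgroup G \<longleftrightarrow>
     subgroup G S_inf \<and>
     closedin (subtopology pointwise_topology (carrier S_inf)) G \<and>
     (\<forall>n. finite (orb G n))"

text \<open>Agreement with the topological definition: a subgroup of \<open>S_inf\<close>, being Hausdorff and
  totally disconnected, is profinite iff it is compact.\<close>

lemma profinite_subgroup_iff_compact:
  "profinite_subgroup G \<longleftrightarrow> subgroup G S_inf \<and> compactin pointwise_topology G"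
proof
  assume prof: "profinite_subgroup G"
  then have sub: "subgroup G S_inf" and fin: "\<And>n. finite (orb G n)"
    by (auto simp: profinite_subgroup_def)
  obtain T where T: "closedin pointwise_topology T" "G = T \<inter> carrier S_inf"
    using prof by (auto simp: profinite_subgroup_def closedin_subtopology)
  have carr: "carrier S_inf = {f. bij f}"
    by (auto simp: BijGroup_def Bij_def)
  have mult: "f \<otimes>\<^bsub>S_inf\<^esub> g = f \<circ> g" if "bij f" "bij g" for f g
    using that by (auto simp: BijGroup_def Bij_def compose_def)
  define K where "K = PiE UNIV (orb G)"
  have K: "compactin pointwise_topology K"
    unfolding K_def pointwise_topology_def
    by (subst compactin_PiE) (auto simp: compactin_discrete_topology fin)
  have op: "openin pointwise_topology {f. f i = a}" for i a
    using openin_continuous_map_preimage[OF continuous_map_product_projection[of i UNIV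
        "\<lambda>_::nat. discrete_topology (UNIV :: nat set)"], of "{a}"]
    by (simp add: pointwise_topology_def)
  have cl_ne: "closedin pointwise_topology {f. f i \<noteq> f j}" for i j
  proof -
    have "openin pointwise_topology (\<Union>a. {f. f i = a} \<inter> {f. f j = a})"
      by (intro openin_Union) (auto intro!: openin_Int op)
    moreover have "(\<Union>a. {f. f i = a} \<inter> {f. f j = a}) = {f :: nat \<Rightarrow> nat. f i = f j}"
      by auto
    moreover have "UNIV - {f :: nat \<Rightarrow> nat. f i \<noteq> f j} = {f. f i = f j}" by auto
    ultimately show ?thesis
      by (simp add: closedin_def pointwise_topology_def)
  qed
  have "closedin pointwise_topology (\<Inter>p\<in>{(i, j). i \<noteq> j}. {f. f (fst p) \<noteq> f (snd p)})"
    by (rule closedin_INT) (use cl_ne n_not_Suc_n[of 0] in auto)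
  moreover have "(\<Inter>p\<in>{(i, j). i \<noteq> j}. {f. f (fst p) \<noteq> f (snd p)}) = {f :: nat \<Rightarrow> nat. inj f}"
    unfolding inj_def by auto (metis)
  ultimately have cl_inj: "closedin pointwise_topology {f. inj f}" by simp
  have orb_sub: "orb G m \<subseteq> orb G n" if m: "m \<in> orb G n" for m n
  proof
    fix x assume "x \<in> orb G m"
    then obtain f g where fg: "f \<in> G" "g \<in> G" "x = f m" "m = g n"
      using m unfolding orb_def by blast
    then have "f \<circ> g \<in> G"
      using subgroup.m_closed[OF sub, of f g] mult T(2) carr by auto
    then show "x \<in> orb G n"
      unfolding orb_def using fg by (intro CollectI exI[of _ "f \<circ> g"]) simp
  qed
  have "(\<lambda>x. x) \<in> G"
    using subgroup.one_closed[OF sub] by (simp add: BijGroup_def restrict_def)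
  then have self: "n \<in> orb G n" for n
    unfolding orb_def by (intro CollectI exI[of _ "\<lambda>x. x"]) simp
  have "f \<in> K \<and> inj f \<longrightarrow> bij f" for f
  proof
    assume f: "f \<in> K \<and> inj f"
    have "n \<in> range f" for n
    proof -
      have "f ` orb G n \<subseteq> orb G n"
        using f orb_sub by (fastforce simp: K_def)
      then have "f ` orb G n = orb G n"
        using f fin by (meson endo_inj_surj inj_on_subset subset_UNIV)
      then show ?thesis using self by blast
    qed
    then show "bij f" using f by (auto simp: bij_def)
  qed
  moreover have "G \<subseteq> K" by (auto simp: K_def orb_def)
  ultimately have "G = K \<inter> (T \<inter> {f. inj f})"
    using T(2) carr by (auto simp: bij_def)
  then show "subgroup G S_inf \<and> compactin pointwise_topology G"
    using sub compact_Int_closedin[OF K closedin_Int[OF T(1) cl_inj]] by simp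
next
  assume a: "subgroup G S_inf \<and> compactin pointwise_topology G"
  have "Hausdorff_space pointwise_topology"
    by (simp add: pointwise_topology_def Hausdorff_space_product_topology)
  then have "closedin pointwise_topology G"
    using a compactin_imp_closedin by blast
  moreover have "G \<subseteq> carrier S_inf" using a subgroup.subset by blast
  ultimately have "closedin (subtopology pointwise_topology (carrier S_inf)) G"
    by (simp add: closedin_subset_topspace closedin_subtopology) blast
  moreover have "finite (orb G n)" for n
  proof -
    have "compactin (discrete_topology UNIV) ((\<lambda>f. f n) ` G)"
      by (rule image_compactin[of pointwise_topology])
        (use a in \<open>auto simp: pointwise_topology_def intro: continuous_map_product_projection\<close>)
    then show ?thesis
      by (simp add: compactin_discrete_topology orb_def image_def setcompr_eq_image)
  qed
  ultimately show "profinite_subgroup G"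
    using a by (simp add: profinite_subgroup_def)
qed

fun orbit_enum :: "(nat \<Rightarrow> nat) set \<Rightarrow> nat \<Rightarrow> nat set" where
  "orbit_enum G 0 = orb G 0"
| "orbit_enum G (Suc n) = orb G (LEAST x. x \<notin> (\<Union>m\<in>{..n}. orbit_enum G m))"

definition orbit_group :: "(nat \<Rightarrow> nat) set \<Rightarrow> nat \<Rightarrow> (nat \<Rightarrow> nat) monoid" where
  "orbit_group G k =
     (BijGroup (orbit_enum G k))\<lparr>carrier := {restrict g (orbit_enum G k) | g. g \<in> G}\<rparr>"

definition orbit_independent :: "(nat \<Rightarrow> nat) set \<Rightarrow> bool" where
  "orbit_independent G \<longleftrightarrow> perm_group G \<cong> product_group UNIV (orbit_group G)"


section \<open>The tree of a permutation group and its degree\<close>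

definition perm_string :: "(nat \<Rightarrow> nat) \<Rightarrow> nat \<Rightarrow> nat list" where
  "perm_string g n = concat (map (\<lambda>i. [g i, inv_into UNIV g i]) [0..<Suc n])"

definition perm_tree :: "(nat \<Rightarrow> nat) set \<Rightarrow> nat list set" where
  "perm_tree G = {perm_string g n | g n. g \<in> G}"

definition imm_succs :: "nat list set \<Rightarrow> nat list \<Rightarrow> nat list set" where
  "imm_succs T \<tau> =
     {\<sigma> \<in> T. strict_prefix \<tau> \<sigma> \<and> \<not> (\<exists>\<rho> \<in> T. strict_prefix \<tau> \<rho> \<and> strict_prefix \<rho> \<sigma>)}"

definition branching :: "nat list set \<Rightarrow> nat list \<Rightarrow> enat" where
  "branching T \<tau> = (if finite (imm_succs T \<tau>) then enat (card (imm_succs T \<tau>)) else \<infinity>)"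

fun enat_encode :: "enat \<Rightarrow> nat" where
  "enat_encode \<infinity> = 0"
| "enat_encode (enat n) = Suc n"

definition branching_graph :: "nat list set \<Rightarrow> nat set" where
  "branching_graph T = {prod_encode (list_encode \<tau>, enat_encode (branching T \<tau>)) | \<tau>. \<tau> \<in> T}"

text \<open>A representative of the join of the degree of the tree and the degree of its branching
  function, the latter being given by its graph.\<close>

definition tree_oracle :: "nat list set \<Rightarrow> nat set" where
  "tree_oracle T = turing_join (list_encode ` T) (branching_graph T)"


section \<open>First-order logic in the language of groups\<close>

datatype gterm = GVar nat | GOne | GMul gterm gterm | GInv gterm

datatype gform =
    GEq gterm gterm
  | GNeg gform
  | GAnd gform gform
  | GOr gform gform
  | GEx nat gform
  | GAll nat gform

primrec term_val :: "('a, 'b) monoid_scheme \<Rightarrow> (nat \<Rightarrow> 'a) \<Rightarrow> gterm \<Rightarrow> 'a" where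
  "term_val M s (GVar v) = s v"
| "term_val M s GOne = \<one>\<^bsub>M\<^esub>"
| "term_val M s (GMul t u) = term_val M s t \<otimes>\<^bsub>M\<^esub> term_val M s u"
| "term_val M s (GInv t) = inv\<^bsub>M\<^esub> (term_val M s t)"

primrec satisfies :: "('a, 'b) monoid_scheme \<Rightarrow> (nat \<Rightarrow> 'a) \<Rightarrow> gform \<Rightarrow> bool" where
  "satisfies M s (GEq t u) \<longleftrightarrow> term_val M s t = term_val M s u"
| "satisfies M s (GNeg \<phi>) \<longleftrightarrow> \<not> satisfies M s \<phi>"
| "satisfies M s (GAnd \<phi> \<psi>) \<longleftrightarrow> satisfies M s \<phi> \<and> satisfies M s \<psi>"
| "satisfies M s (GOr \<phi> \<psi>) \<longleftrightarrow> satisfies M s \<phi> \<or> satisfies M s \<psi>"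
| "satisfies M s (GEx v \<phi>) \<longleftrightarrow> (\<exists>a \<in> carrier M. satisfies M (s(v := a)) \<phi>)"
| "satisfies M s (GAll v \<phi>) \<longleftrightarrow> (\<forall>a \<in> carrier M. satisfies M (s(v := a)) \<phi>)"

primrec term_vars :: "gterm \<Rightarrow> nat set" where
  "term_vars (GVar v) = {v}"
| "term_vars GOne = {}"
| "term_vars (GMul t u) = term_vars t \<union> term_vars u"
| "term_vars (GInv t) = term_vars t"

primrec free_vars :: "gform \<Rightarrow> nat set" where
  "free_vars (GEq t u) = term_vars t \<union> term_vars u"
| "free_vars (GNeg \<phi>) = free_vars \<phi>"
| "free_vars (GAnd \<phi> \<psi>) = free_vars \<phi> \<union> free_vars \<psi>"
| "free_vars (GOr \<phi> \<psi>) = free_vars \<phi> \<union> free_vars \<psi>"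
| "free_vars (GEx v \<phi>) = free_vars \<phi> - {v}"
| "free_vars (GAll v \<phi>) = free_vars \<phi> - {v}"

primrec quantifier_free :: "gform \<Rightarrow> bool" where
  "quantifier_free (GEq t u) \<longleftrightarrow> True"
| "quantifier_free (GNeg \<phi>) \<longleftrightarrow> quantifier_free \<phi>"
| "quantifier_free (GAnd \<phi> \<psi>) \<longleftrightarrow> quantifier_free \<phi> \<and> quantifier_free \<psi>"
| "quantifier_free (GOr \<phi> \<psi>) \<longleftrightarrow> quantifier_free \<phi> \<and> quantifier_free \<psi>"
| "quantifier_free (GEx v \<phi>) \<longleftrightarrow> False"
| "quantifier_free (GAll v \<phi>) \<longleftrightarrow> False"

inductive existential :: "gform \<Rightarrow> bool" where
  "quantifier_free \<phi> \<Longrightarrow> existential \<phi>"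
| "existential \<phi> \<Longrightarrow> existential (GEx v \<phi>)"

definition true_in :: "('a, 'b) monoid_scheme \<Rightarrow> gform \<Rightarrow> bool" where
  "true_in M \<phi> \<longleftrightarrow> (\<forall>s. range s \<subseteq> carrier M \<longrightarrow> satisfies M s \<phi>)"

definition existential_theory :: "('a, 'b) monoid_scheme \<Rightarrow> gform set" where
  "existential_theory M = {\<phi>. existential \<phi> \<and> free_vars \<phi> = {} \<and> true_in M \<phi>}"

primrec term_encode :: "gterm \<Rightarrow> nat" where
  "term_encode (GVar v) = prod_encode (0, v)"
| "term_encode GOne = prod_encode (1, 0)"
| "term_encode (GMul t u) = prod_encode (2, prod_encode (term_encode t, term_encode u))"
| "term_encode (GInv t) = prod_encode (3, term_encode t)"

primrec form_encode :: "gform \<Rightarrow> nat" where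
  "form_encode (GEq t u) = prod_encode (0, prod_encode (term_encode t, term_encode u))"
| "form_encode (GNeg \<phi>) = prod_encode (1, form_encode \<phi>)"
| "form_encode (GAnd \<phi> \<psi>) = prod_encode (2, prod_encode (form_encode \<phi>, form_encode \<psi>))"
| "form_encode (GOr \<phi> \<psi>) = prod_encode (3, prod_encode (form_encode \<phi>, form_encode \<psi>))"
| "form_encode (GEx v \<phi>) = prod_encode (4, prod_encode (v, form_encode \<phi>))"
| "form_encode (GAll v \<phi>) = prod_encode (5, prod_encode (v, form_encode \<phi>))"

lemma term_encode_inject: "term_encode t = term_encode u \<Longrightarrow> t = u"
proof (induction t arbitrary: u)
  case (GVar v) then show ?case by (cases u) auto
next
  case GOne then show ?case by (cases u) auto
next
  case (GMul t1 t2) then show ?case by (cases u) auto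
next
  case (GInv t) then show ?case by (cases u) auto
qed

lemma form_encode_inject: "form_encode \<phi> = form_encode \<psi> \<Longrightarrow> \<phi> = \<psi>"
proof (induction \<phi> arbitrary: \<psi>)
  case (GEq t u) then show ?case by (cases \<psi>) (auto dest: term_encode_inject)
next
  case (GNeg \<phi>) then show ?case by (cases \<psi>) auto
next
  case (GAnd \<phi>1 \<phi>2) then show ?case by (cases \<psi>) auto
next
  case (GOr \<phi>1 \<phi>2) then show ?case by (cases \<psi>) auto
next
  case (GEx v \<phi>) then show ?case by (cases \<psi>) auto
next
  case (GAll v \<phi>) then show ?case by (cases \<psi>) auto
qed

end

theory Submission
  imports Defs
begin

text \<open>
  An existential sentence is an isomorphism invariant, so \<open>G\<close> may be replaced by the full product
  of the groups \<open>H\<^sub>k\<close>, realised as the group of all permutations that agree on each orbit with some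
  element of \<open>G\<close>. A quantifier-free formula has finitely many atoms, and each failing equation
  fails at one point; hence a satisfying assignment can be cut down to the identity outside a finite
  union of orbits, and conversely such a finitely supported assignment is already one in the
  product. So the sentence is true iff a finite witness exists. Whether a finite table is a
  witness is decidable from \<open>deg T\<^sub>G\<close>: the branching function bounds the codes on each level of the
  tree, which makes the orbits and the groups \<open>H\<^sub>k\<close> computable.
\<close>

section \<open>Closure properties of relative computability\<close>

text \<open>Orbit independence supplies only an abstract isomorphism, so \<open>G\<close> itself may
  fail to contain the permutations glued from different group elements on different orbits. How the
  isomorphism acts is irrelevant: truth of an existential sentence transfers along it, and the
  sentence is then evaluated in \<open>orbitwise G\<close>. The tree of \<open>G\<close> still
  suffices as oracle, because membership in \<open>orbitwise G\<close> is tested one orbit at a time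
  against elements of \<open>G\<close>. The size of a witness is searched without bound, whence the
  outer existential quantifier. Checking one given table needs computable bounds on finite sets of
  codes, and finiteness of the orbits alone gives none; counting successors does.\<close>

abbreviation pfst :: "nat \<Rightarrow> nat" where
  "pfst n \<equiv> fst (prod_decode n)"

abbreviation psnd :: "nat \<Rightarrow> nat" where
  "psnd n \<equiv> snd (prod_decode n)"

text \<open>Predicates enter as \<open>of_bool\<close> valued functions, so computability of a
  composite definition is proved by following its syntax with these rules.\<close>

named_theorems rec_intros

lemma recursive_id [rec_intros]: "recursive_in A (\<lambda>x. x)"
  using recursive_in.pair[OF recursive_in.left recursive_in.right, of A] by simp

lemma recursive_const [rec_intros]: "recursive_in A (\<lambda>x. c)"
  by (induction c) (auto intro: recursive_in.zero recursive_in.comp[OF recursive_in.succ])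

lemma recursive_Suc [rec_intros]: "recursive_in A f \<Longrightarrow> recursive_in A (\<lambda>x. Suc (f x))"
  by (rule recursive_in.comp[OF recursive_in.succ])

lemma recursive_pfst [rec_intros]: "recursive_in A f \<Longrightarrow> recursive_in A (\<lambda>x. pfst (f x))"
  by (rule recursive_in.comp[OF recursive_in.left])

lemma recursive_psnd [rec_intros]: "recursive_in A f \<Longrightarrow> recursive_in A (\<lambda>x. psnd (f x))"
  by (rule recursive_in.comp[OF recursive_in.right])

lemmas [rec_intros] = recursive_in.pair

lemma recursive_query [rec_intros]:
  "recursive_in A f \<Longrightarrow> recursive_in A (\<lambda>x. of_bool (f x \<in> A))"
  by (rule recursive_in.comp[OF recursive_in.query])

text \<open>The parameter of \<open>recursive_in.prec\<close> is taken to be the whole input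
  \<open>x\<close>, so that start value, step and length may all depend on it; the step is checked
  on the code of parameter, index and accumulator.\<close>

lemma recursive_rec_nat [rec_intros]:
  assumes "recursive_in A f"
    and "recursive_in A (\<lambda>z. g (pfst z) (pfst (psnd z)) (psnd (psnd z)))"
    and "recursive_in A n"
  shows "recursive_in A (\<lambda>x. rec_nat (f x) (\<lambda>i r. g x i r) (n x))"
  using recursive_in.comp[OF recursive_in.prec[OF assms(1,2)]
      recursive_in.pair[OF recursive_id assms(3)]] by simp

lemma recursive_If [rec_intros]:
  assumes "recursive_in A (\<lambda>x. of_bool (P x))" "recursive_in A f" "recursive_in A g"
  shows "recursive_in A (\<lambda>x. if P x then f x else g x)"
proof -
  \<comment> \<open>A case distinction is a primitive recursion with zero or one rounds.\<close>
  have "recursive_in A (\<lambda>x. rec_nat (g x) (\<lambda>i r. f x) (of_bool (P x)))"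
    by (intro rec_intros assms recursive_in.comp[OF assms(2)])
  moreover have "(\<lambda>x. rec_nat (g x) (\<lambda>i r. f x) (of_bool (P x))) = (\<lambda>x. if P x then f x else g x)"
    by auto
  ultimately show ?thesis by simp
qed

lemma decidable_not [rec_intros]:
  assumes "recursive_in A (\<lambda>x. of_bool (P x))"
  shows "recursive_in A (\<lambda>x. of_bool (\<not> P x))"
proof -
  have "recursive_in A (\<lambda>x. if P x then 0 else 1)"
    by (intro rec_intros assms)
  moreover have "(\<lambda>x. if P x then 0 else 1) = (\<lambda>x. of_bool (\<not> P x) :: nat)"
    by auto
  ultimately show ?thesis by simp
qed

lemma decidable_conj [rec_intros]:
  assumes "recursive_in A (\<lambda>x. of_bool (P x))" "recursive_in A (\<lambda>x. of_bool (Q x))"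
  shows "recursive_in A (\<lambda>x. of_bool (P x \<and> Q x))"
proof -
  have "recursive_in A (\<lambda>x. if P x then of_bool (Q x) else 0)"
    by (intro rec_intros assms)
  moreover have "(\<lambda>x. if P x then of_bool (Q x) else 0) = (\<lambda>x. of_bool (P x \<and> Q x) :: nat)"
    by auto
  ultimately show ?thesis by simp
qed

lemma decidable_disj [rec_intros]:
  assumes "recursive_in A (\<lambda>x. of_bool (P x))" "recursive_in A (\<lambda>x. of_bool (Q x))"
  shows "recursive_in A (\<lambda>x. of_bool (P x \<or> Q x))"
proof -
  have "recursive_in A (\<lambda>x. of_bool (\<not> (\<not> P x \<and> \<not> Q x)))"
    by (intro rec_intros assms)
  then show ?thesis by simp
qed

lemma decidable_imp [rec_intros]:
  assumes "recursive_in A (\<lambda>x. of_bool (P x))" "recursive_in A (\<lambda>x. of_bool (Q x))"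
  shows "recursive_in A (\<lambda>x. of_bool (P x \<longrightarrow> Q x))"
proof -
  have "recursive_in A (\<lambda>x. of_bool (\<not> P x \<or> Q x))"
    by (intro rec_intros assms)
  then show ?thesis by simp
qed

lemma recursive_add [rec_intros]:
  assumes "recursive_in A f" "recursive_in A g"
  shows "recursive_in A (\<lambda>x. f x + g x)"
proof -
  have "rec_nat a (\<lambda>i r. Suc r) b = a + b" for a b by (induction b) auto
  moreover have "recursive_in A (\<lambda>x. rec_nat (f x) (\<lambda>i r. Suc r) (g x))"
    by (intro rec_intros assms)
  ultimately show ?thesis by simp
qed

lemma recursive_pred [rec_intros]:
  assumes "recursive_in A f"
  shows "recursive_in A (\<lambda>x. f x - 1)"
proof -
  have "rec_nat 0 (\<lambda>i r. i) b = b - 1" for b by (induction b) auto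
  moreover have "recursive_in A (\<lambda>x. rec_nat 0 (\<lambda>i r. i) (f x))"
    by (intro rec_intros assms)
  ultimately show ?thesis by simp
qed

lemma recursive_diff [rec_intros]:
  assumes "recursive_in A f" "recursive_in A g"
  shows "recursive_in A (\<lambda>x. f x - g x)"
proof -
  have "rec_nat a (\<lambda>i r. r - 1) b = a - b" for a b :: nat by (induction b) auto
  moreover have "recursive_in A (\<lambda>x. rec_nat (f x) (\<lambda>i r. r - 1) (g x))"
    by (intro rec_intros assms)
  ultimately show ?thesis by simp
qed

lemma decidable_le [rec_intros]:
  assumes "recursive_in A f" "recursive_in A g"
  shows "recursive_in A (\<lambda>x. of_bool (f x \<le> g x))"
proof -
  have "recursive_in A (\<lambda>x. rec_nat (Suc 0) (\<lambda>i r. 0) (f x - g x))"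
    by (intro rec_intros assms)
  moreover have "rec_nat (Suc 0) (\<lambda>i r. 0) (a - b) = of_bool (a \<le> b)" for a b :: nat
    by (cases "a - b") auto
  ultimately show ?thesis by simp
qed

lemma decidable_less [rec_intros]:
  assumes "recursive_in A f" "recursive_in A g"
  shows "recursive_in A (\<lambda>x. of_bool (f x < g x))"
  using decidable_le[OF recursive_Suc[OF assms(1)] assms(2)] by (simp add: Suc_le_eq)

lemma decidable_eq [rec_intros]:
  fixes f g :: "nat \<Rightarrow> nat"
  assumes "recursive_in A f" "recursive_in A g"
  shows "recursive_in A (\<lambda>x. of_bool (f x = g x))"
  using decidable_conj[OF decidable_le[OF assms] decidable_le[OF assms(2,1)]]
  by (simp add: order_eq_iff)

section \<open>Bounded quantifiers, bounded sums and unbounded search\<close>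

lemma decidable_ball_less [rec_intros]:
  assumes "recursive_in A (\<lambda>z. of_bool (P (pfst z) (psnd z)))" "recursive_in A b"
  shows "recursive_in A (\<lambda>x. of_bool (\<forall>i<b x. P x i))"
proof -
  have "rec_nat (Suc 0) (\<lambda>i r. if P x i then r else 0) n = of_bool (\<forall>i<n. P x i)" for x n
    by (induction n) (auto simp: less_Suc_eq)
  moreover have "recursive_in A (\<lambda>x. rec_nat (Suc 0) (\<lambda>i r. if P x i then r else 0) (b x))"
  proof (intro rec_intros assms)
    show "recursive_in A (\<lambda>z. of_bool (P (pfst z) (pfst (psnd z))))"
      \<comment> \<open>The recursion passes parameter, index and accumulator; the tuple is
        rearranged to the pair of parameter and index that \<open>P\<close> expects.\<close>
      using recursive_in.comp[OF assms(1), of "\<lambda>z. prod_encode (pfst z, pfst (psnd z))"]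
      by (simp add: rec_intros)
  qed
  ultimately show ?thesis by simp
qed

lemma decidable_bex_less [rec_intros]:
  assumes "recursive_in A (\<lambda>z. of_bool (P (pfst z) (psnd z)))" "recursive_in A b"
  shows "recursive_in A (\<lambda>x. of_bool (\<exists>i<b x. P x i))"
proof -
  have "recursive_in A (\<lambda>x. of_bool (\<not> (\<forall>i<b x. \<not> P x i)))"
    by (intro rec_intros assms)
  then show ?thesis by simp
qed

lemma recursive_sum_less [rec_intros]:
  assumes "recursive_in A (\<lambda>z. f (pfst z) (psnd z))" "recursive_in A b"
  shows "recursive_in A (\<lambda>x. \<Sum>i<b x. f x i)"
proof -
  have "rec_nat 0 (\<lambda>i r. r + f x i) n = (\<Sum>i<n. f x i)" for x n
    by (induction n) auto
  moreover have "recursive_in A (\<lambda>x. rec_nat 0 (\<lambda>i r. r + f x i) (b x))"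
  proof (intro rec_intros assms)
    show "recursive_in A (\<lambda>z. f (pfst z) (pfst (psnd z)))"
      using recursive_in.comp[OF assms(1), of "\<lambda>z. prod_encode (pfst z, pfst (psnd z))"]
      by (simp add: rec_intros)
  qed
  ultimately show ?thesis by simp
qed

text \<open>\<open>recursive_in.mu\<close> looks for a zero, so the negated predicate is minimised;
  the second premise makes the search regular.\<close>

lemma recursive_Least:
  assumes "recursive_in A (\<lambda>z. of_bool (P (pfst z) (psnd z)))" "\<And>x. \<exists>n. P x n"
  shows "recursive_in A (\<lambda>x. LEAST n. P x n)"
proof -
  have "recursive_in A (\<lambda>z. of_bool (\<not> P (pfst z) (psnd z)))"
    by (intro rec_intros assms)
  from recursive_in.mu[OF this] show ?thesis using assms(2) by simp
qed


section \<open>Codes of lists and recursion on codes\<close>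

text \<open>\<open>list_encode\<close> maps the empty list to 0 and a cons to the successor of a
  pair, so \<open>psnd (r - 1)\<close> is the tail. The code 0 is fixed by this step, so dropping
  too many entries stays at 0.\<close>

definition code_drop :: "nat \<Rightarrow> nat \<Rightarrow> nat" where
  "code_drop c i = rec_nat c (\<lambda>_ r. psnd (r - 1)) i"

definition code_nth :: "nat \<Rightarrow> nat \<Rightarrow> nat" where
  "code_nth c i = pfst (code_drop c i - 1)"

definition code_length :: "nat \<Rightarrow> nat" where
  "code_length c = (LEAST i. code_drop c i = 0)"

lemma code_drop_0 [simp]: "code_drop c 0 = c"
  by (simp add: code_drop_def)

lemma code_drop_Cons [simp]: "code_drop (Suc (prod_encode (x, c))) (Suc i) = code_drop c i"
  by (induction i) (simp_all add: code_drop_def)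

lemma code_drop_Nil [simp]: "code_drop 0 i = 0"
proof (induction i)
  case (Suc i)
  have "prod_decode 0 = (0, 0)" by (simp add: prod_decode_def prod_decode_aux.simps)
  with Suc show ?case by (simp add: code_drop_def)
qed simp

lemma code_nth_Cons_0 [simp]: "code_nth (Suc (prod_encode (x, c))) 0 = x"
  by (simp add: code_nth_def)

lemma code_nth_Cons_Suc [simp]: "code_nth (Suc (prod_encode (x, c))) (Suc i) = code_nth c i"
  by (simp add: code_nth_def)

lemma code_drop_list_encode: "code_drop (list_encode xs) i = list_encode (drop i xs)"
proof (induction xs arbitrary: i)
  case (Cons x xs) then show ?case by (cases i) auto
qed simp

lemma code_nth_list_encode: "i < length xs \<Longrightarrow> code_nth (list_encode xs) i = xs ! i"
  using Cons_nth_drop_Suc[of i xs, symmetric] by (simp add: code_nth_def code_drop_list_encode)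

lemma list_encode_eq_0_iff: "list_encode xs = 0 \<longleftrightarrow> xs = []"
  by (cases xs) auto

lemma code_length_list_encode: "code_length (list_encode xs) = length xs"
  unfolding code_length_def code_drop_list_encode list_encode_eq_0_iff
  by (rule Least_equality) auto

text \<open>This is what turns a bound on codes of tree strings into a bound on the orbit elements
  occurring in them.\<close>

lemma nth_less_list_encode: "i < length xs \<Longrightarrow> xs ! i < list_encode xs"
proof (induction xs arbitrary: i)
  case (Cons x xs)
  have "x < list_encode (x # xs)" "list_encode xs < list_encode (x # xs)"
    by (auto simp: le_imp_less_Suc le_prod_encode_1 le_prod_encode_2)
  with Cons show ?case by (cases i) (auto intro: order.strict_trans)
qed simp

lemma recursive_code_drop [rec_intros]:
  assumes "recursive_in A f" "recursive_in A g"
  shows "recursive_in A (\<lambda>x. code_drop (f x) (g x))"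
  unfolding code_drop_def by (intro rec_intros assms)

lemma recursive_code_nth [rec_intros]:
  assumes "recursive_in A f" "recursive_in A g"
  shows "recursive_in A (\<lambda>x. code_nth (f x) (g x))"
  unfolding code_nth_def by (intro rec_intros assms)

lemma recursive_code_length [rec_intros]:
  assumes "recursive_in A f"
  shows "recursive_in A (\<lambda>x. code_length (f x))"
proof -
  have "\<exists>n. code_drop c n = 0" for c
    using code_drop_list_encode[of "list_decode c" "length (list_decode c)"] by auto
  then have "recursive_in A (\<lambda>c. code_length c)"
    unfolding code_length_def by (intro recursive_Least rec_intros)
  from recursive_in.comp[OF this assms] show ?thesis .
qed

lemma recursive_tabulate [rec_intros]:
  assumes "recursive_in A (\<lambda>z. f (pfst z) (psnd z))" "recursive_in A n"
  shows "recursive_in A (\<lambda>x. list_encode (map (\<lambda>i. f x i) [0..<n x]))"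
proof -
  \<comment> \<open>Codes grow at the front, so the table is built from its last entry backwards:
    after \<open>k\<close> rounds it covers the last \<open>k\<close> positions.\<close>
  have tab: "rec_nat 0 (\<lambda>i r. Suc (prod_encode (f x (m - Suc i), r))) k
      = list_encode (map (f x) [m - k..<m])" if "k \<le> m" for x m k
    using that
  proof (induction k)
    case (Suc k)
    then have "[m - Suc k..<m] = (m - Suc k) # [m - k..<m]"
      by (simp add: upt_conv_Cons Suc_diff_Suc)
    with Suc show ?case by simp
  qed simp
  have "recursive_in A (\<lambda>x. rec_nat 0 (\<lambda>i r. Suc (prod_encode (f x (n x - Suc i), r))) (n x))"
  proof (intro rec_intros assms)
    have "recursive_in A (\<lambda>z. prod_encode (pfst z, n (pfst z) - Suc (pfst (psnd z))))"
      by (intro rec_intros recursive_in.comp[OF assms(2)])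
    from recursive_in.comp[OF assms(1) this]
    show "recursive_in A (\<lambda>z. f (pfst z) (n (pfst z) - Suc (pfst (psnd z))))" by simp
  qed
  then show ?thesis by (simp add: tab)
qed

text \<open>A nonzero tag lifts the Cantor code strictly above its second component. At tag 0 this
  can fail, as it does at code 0, which is why only nonzero tags may have subtrees.\<close>

lemma psnd_less: "pfst n \<noteq> 0 \<Longrightarrow> psnd n < n"
proof -
  assume "pfst n \<noteq> 0"
  have "b < prod_encode (a, b)" if "a \<noteq> 0" for a b
  proof -
    have "k \<le> triangle k" for k by (induction k) auto
    from this[of "a + b"] show ?thesis using that by (simp add: prod_encode_def)
  qed
  from this[of "pfst n" "psnd n"] \<open>pfst n \<noteq> 0\<close> show ?thesis by simp
qed

lemma pfst_le: "pfst n \<le> n" and psnd_le: "psnd n \<le> n"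
  using le_prod_encode_1[of "pfst n" "psnd n"] le_prod_encode_2[of "psnd n" "pfst n"] by simp_all

text \<open>Structural recursion on codes of syntax trees. A code is a pair of a tag and an argument, and
  the immediate subtrees sit at the argument itself or at one of its two components; tag \<open>0\<close> marks
  a leaf.\<close>

function code_rec ::
  "(nat \<Rightarrow> nat \<Rightarrow> nat \<Rightarrow> nat \<Rightarrow> nat \<Rightarrow> nat \<Rightarrow> nat) \<Rightarrow> nat \<Rightarrow> nat \<Rightarrow> nat" where
  "code_rec g a n =
     (if pfst n = 0 then g a 0 (psnd n) 0 0 0
      else g a (pfst n) (psnd n) (code_rec g a (psnd n))
        (code_rec g a (pfst (psnd n))) (code_rec g a (psnd (psnd n))))"
  by pat_completeness auto
termination
  by (relation "measure (\<lambda>(g, a, n). n)")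
    (auto intro: psnd_less le_less_trans[OF pfst_le psnd_less] le_less_trans[OF psnd_le psnd_less])

declare code_rec.simps [simp del]

text \<open>Recursive calls reach arbitrary smaller codes, so a plain \<open>rec_nat\<close> carries
  the list of all earlier values, newest first.\<close>

lemma recursive_code_rec [rec_intros]:
  assumes g: "recursive_in A (\<lambda>z. g (pfst z) (pfst (psnd z)) (pfst (psnd (psnd z)))
      (pfst (psnd (psnd (psnd z)))) (pfst (psnd (psnd (psnd (psnd z)))))
      (psnd (psnd (psnd (psnd (psnd z))))))"
    and a: "recursive_in A a" and n: "recursive_in A n"
  shows "recursive_in A (\<lambda>x. code_rec g (a x) (n x))"
proof -
  define G where "G a i r = (if pfst i = 0 then g a 0 (psnd i) 0 0 0
      else g a (pfst i) (psnd i) (code_nth r (i - Suc (psnd i)))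
        (code_nth r (i - Suc (pfst (psnd i)))) (code_nth r (i - Suc (psnd (psnd i)))))" for a i r
  define hist where "hist a = rec_nat 0 (\<lambda>i r. Suc (prod_encode (G a i r, r)))" for a
  \<comment> \<open>After \<open>n\<close> rounds the value at \<open>j\<close> has been pushed down
    by \<open>n - Suc j\<close> later ones.\<close>
  have nth_hist: "code_nth (hist a n) (n - Suc j) = code_rec g a j" if "j < n" for a n j
    using that
  proof (induction n arbitrary: j)
    case (Suc n)
    show ?case
    proof (cases "j = n")
      case True
      have "G a n (hist a n) = code_rec g a n"
        using Suc.IH psnd_less[of n] le_less_trans[OF pfst_le psnd_less, of n]
          le_less_trans[OF psnd_le psnd_less, of n]
        by (subst code_rec.simps) (simp add: G_def)
      then show ?thesis using True by (simp add: hist_def)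
    next
      case False
      then have "Suc n - Suc j = Suc (n - Suc j)" using Suc.prems by auto
      then show ?thesis using Suc False by (simp add: hist_def)
    qed
  qed simp
  have g': "recursive_in A (\<lambda>z. g (p z) (q z) (r z) (s z) (t z) (u z))"
    if "recursive_in A p" "recursive_in A q" "recursive_in A r" "recursive_in A s"
      "recursive_in A t" "recursive_in A u" for p q r s t u
    using recursive_in.comp[OF g, of "\<lambda>z. prod_encode (p z, prod_encode (q z, prod_encode (r z,
        prod_encode (s z, prod_encode (t z, u z)))))"] that
    by (simp add: recursive_in.pair)
  have "recursive_in A (\<lambda>x. code_nth (hist (a x) (Suc (n x))) 0)"
    unfolding hist_def G_def
    by (intro rec_intros g' a n recursive_in.comp[OF a])
  moreover have "code_nth (hist b (Suc m)) 0 = code_rec g b m" for b m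
    using nth_hist[of m "Suc m" b] by simp
  ultimately show ?thesis by simp
qed


section \<open>Existential sentences and their matrices\<close>

text \<open>The quantifier prefix is skipped because its witnesses are read off the assignment.
  \<open>False\<close> at \<open>GAll\<close> is a mere default: existential formulas contain no
  universal quantifier.\<close>

primrec matrix_sat :: "('a, 'b) monoid_scheme \<Rightarrow> (nat \<Rightarrow> 'a) \<Rightarrow> gform \<Rightarrow> bool" where
  "matrix_sat M s (GEq t u) \<longleftrightarrow> term_val M s t = term_val M s u"
| "matrix_sat M s (GNeg \<phi>) \<longleftrightarrow> \<not> matrix_sat M s \<phi>"
| "matrix_sat M s (GAnd \<phi> \<psi>) \<longleftrightarrow> matrix_sat M s \<phi> \<and> matrix_sat M s \<psi>"
| "matrix_sat M s (GOr \<phi> \<psi>) \<longleftrightarrow> matrix_sat M s \<phi> \<or> matrix_sat M s \<psi>"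
| "matrix_sat M s (GEx v \<phi>) \<longleftrightarrow> matrix_sat M s \<phi>"
| "matrix_sat M s (GAll v \<phi>) \<longleftrightarrow> False"

lemma term_val_cong: "(\<And>v. v \<in> term_vars t \<Longrightarrow> s v = s' v) \<Longrightarrow> term_val M s t = term_val M s' t"
  by (induction t) auto

lemma matrix_sat_cong:
  "quantifier_free \<phi> \<Longrightarrow> (\<And>v. v \<in> free_vars \<phi> \<Longrightarrow> s v = s' v) \<Longrightarrow>
    matrix_sat M s \<phi> \<longleftrightarrow> matrix_sat M s' \<phi>"
proof (induction \<phi>)
  case (GEq t u)
  then show ?case using term_val_cong[of t s s' M] term_val_cong[of u s s' M] by simp
qed auto

lemma satisfies_iff_matrix_sat: "quantifier_free \<phi> \<Longrightarrow> satisfies M s \<phi> \<longleftrightarrow> matrix_sat M s \<phi>"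
  by (induction \<phi>) auto

text \<open>The witnesses of the whole prefix are collected in one assignment \<open>s'\<close>,
  which is tied to \<open>s\<close> only at free variables. If a variable is quantified twice, the
  inner witness is the one kept.\<close>

lemma satisfies_existential_iff:
  assumes "existential \<phi>" "range s \<subseteq> carrier M"
  shows "satisfies M s \<phi> \<longleftrightarrow>
    (\<exists>s'. range s' \<subseteq> carrier M \<and> (\<forall>v\<in>free_vars \<phi>. s' v = s v) \<and> matrix_sat M s' \<phi>)"
  using assms
proof (induction arbitrary: s)
  case (1 \<phi>)
  then show ?case using matrix_sat_cong satisfies_iff_matrix_sat by metis
next
  case (2 \<phi> v)
  have upd: "range (s(v := a)) \<subseteq> carrier M" if "a \<in> carrier M" for a
    using that 2(3) by auto
  show ?case
  proof
    assume "satisfies M s (GEx v \<phi>)"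
    then obtain a where a: "a \<in> carrier M" "satisfies M (s(v := a)) \<phi>" by auto
    then obtain s' where "range s' \<subseteq> carrier M" "\<forall>w\<in>free_vars \<phi>. s' w = (s(v := a)) w"
      "matrix_sat M s' \<phi>" using 2(2)[OF upd] by blast
    then show "\<exists>s'. range s' \<subseteq> carrier M \<and> (\<forall>w\<in>free_vars (GEx v \<phi>). s' w = s w) \<and>
        matrix_sat M s' (GEx v \<phi>)" by (intro exI[of _ s']) auto
  next
    assume "\<exists>s'. range s' \<subseteq> carrier M \<and> (\<forall>w\<in>free_vars (GEx v \<phi>). s' w = s w) \<and>
        matrix_sat M s' (GEx v \<phi>)"
    then obtain s' where s': "range s' \<subseteq> carrier M" "\<forall>w\<in>free_vars (GEx v \<phi>). s' w = s w"
      "matrix_sat M s' \<phi>" by auto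
    then have "s' v \<in> carrier M" by auto
    moreover have "\<forall>w\<in>free_vars \<phi>. s' w = (s(v := s' v)) w" using s'(2) by auto
    ultimately have "satisfies M (s(v := s' v)) \<phi>" using s' 2(2)[OF upd] by blast
    with \<open>s' v \<in> carrier M\<close> show "satisfies M s (GEx v \<phi>)" by auto
  qed
qed

lemma true_in_existential_iff:
  assumes "existential \<phi>" "free_vars \<phi> = {}" "group M"
  shows "true_in M \<phi> \<longleftrightarrow> (\<exists>s. range s \<subseteq> carrier M \<and> matrix_sat M s \<phi>)"
proof -
  \<comment> \<open>Truth quantifies over all assignments; the constant one shows that there is an
    assignment at all.\<close>
  have "range (\<lambda>_::nat. \<one>\<^bsub>M\<^esub>) \<subseteq> carrier M"
    using group.is_monoid[OF assms(3)] by (auto simp: monoid.one_closed)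
  then show ?thesis
    unfolding true_in_def using satisfies_existential_iff[OF assms(1), of _ M] assms(2) by auto
qed

lemma term_val_in_carrier:
  assumes "group M" "range s \<subseteq> carrier M"
  shows "term_val M s t \<in> carrier M"
proof -
  interpret group M by fact
  show ?thesis using assms(2) by (induction t) auto
qed

lemma term_val_iso:
  assumes "group M" "group N" "h \<in> iso M N" "range s \<subseteq> carrier M"
  shows "term_val N (h \<circ> s) t = h (term_val M s t)"
proof -
  interpret h: group_hom M N h
    using assms by (simp add: group_hom_def group_hom_axioms_def iso_imp_homomorphism)
  show ?thesis
    by (induction t) (auto simp: term_val_in_carrier[OF assms(1,4)])
qed

lemma matrix_sat_iso:
  assumes "group M" "group N" "h \<in> iso M N" "range s \<subseteq> carrier M"
  shows "matrix_sat N (h \<circ> s) \<phi> \<longleftrightarrow> matrix_sat M s \<phi>"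
proof -
  have "inj_on h (carrier M)" using assms(3) by (auto simp: iso_def bij_betw_def)
  then show ?thesis
    using term_val_in_carrier[OF assms(1,4)]
    by (induction \<phi>) (auto simp: term_val_iso[OF assms] inj_on_eq_iff)
qed

lemma true_in_existential_iso_imp:
  assumes "existential \<phi>" "free_vars \<phi> = {}" "group M" "group N" "M \<cong> N" "true_in M \<phi>"
  shows "true_in N \<phi>"
proof -
  obtain h where h: "h \<in> iso M N" using assms(5) by (auto simp: is_iso_def)
  obtain s where s: "range s \<subseteq> carrier M" "matrix_sat M s \<phi>"
    using assms(6) true_in_existential_iff[OF assms(1-3)] by auto
  have "range (h \<circ> s) \<subseteq> carrier N"
    using h s(1) by (auto simp: iso_def hom_def)
  moreover have "matrix_sat N (h \<circ> s) \<phi>"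
    using s matrix_sat_iso[OF assms(3,4) h] by simp
  ultimately show ?thesis
    unfolding true_in_existential_iff[OF assms(1,2,4)] by blast
qed

lemma true_in_existential_iso:
  assumes "existential \<phi>" "free_vars \<phi> = {}" "group M" "group N" "M \<cong> N"
  shows "true_in M \<phi> \<longleftrightarrow> true_in N \<phi>"
  using true_in_existential_iso_imp[OF assms]
    true_in_existential_iso_imp[OF assms(1,2,4,3) group.iso_sym[OF assms(3,5)]] by blast


section \<open>Words and matrices evaluated on permutations\<close>

abbreviation pinv :: "(nat \<Rightarrow> nat) \<Rightarrow> nat \<Rightarrow> nat" where
  "pinv \<equiv> inv_into UNIV"

text \<open>Multiplication in \<open>BijGroup\<close> is composition only on bijections; composing
  plain functions frees the later computations from side conditions.\<close>

primrec perm_val :: "(nat \<Rightarrow> nat \<Rightarrow> nat) \<Rightarrow> gterm \<Rightarrow> nat \<Rightarrow> nat" where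
  "perm_val s (GVar v) = s v"
| "perm_val s GOne = id"
| "perm_val s (GMul t u) = perm_val s t \<circ> perm_val s u"
| "perm_val s (GInv t) = pinv (perm_val s t)"

primrec perm_sat :: "(nat \<Rightarrow> nat \<Rightarrow> nat) \<Rightarrow> gform \<Rightarrow> bool" where
  "perm_sat s (GEq t u) \<longleftrightarrow> perm_val s t = perm_val s u"
| "perm_sat s (GNeg \<phi>) \<longleftrightarrow> \<not> perm_sat s \<phi>"
| "perm_sat s (GAnd \<phi> \<psi>) \<longleftrightarrow> perm_sat s \<phi> \<and> perm_sat s \<psi>"
| "perm_sat s (GOr \<phi> \<psi>) \<longleftrightarrow> perm_sat s \<phi> \<or> perm_sat s \<psi>"
| "perm_sat s (GEx v \<phi>) \<longleftrightarrow> perm_sat s \<phi>"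
| "perm_sat s (GAll v \<phi>) \<longleftrightarrow> False"

lemma S_inf_carrier: "carrier S_inf = {f. bij f}"
  by (auto simp: BijGroup_def Bij_def)

lemma S_inf_one: "\<one>\<^bsub>S_inf\<^esub> = id"
  by (auto simp: BijGroup_def)

lemma S_inf_mult: "bij f \<Longrightarrow> bij g \<Longrightarrow> f \<otimes>\<^bsub>S_inf\<^esub> g = f \<circ> g"
  by (auto simp: BijGroup_def Bij_def compose_def)

lemma S_inf_inv: "bij f \<Longrightarrow> inv\<^bsub>S_inf\<^esub> f = pinv f"
  by (subst inv_BijGroup) (auto simp: Bij_def)

lemma term_val_perm_group:
  assumes "subgroup H S_inf" "range s \<subseteq> H"
  shows "term_val (perm_group H) s t = perm_val s t"
proof -
  have grp: "group (perm_group H)"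
    using assms(1) subgroup.subgroup_is_group[OF _ group_BijGroup] by blast
  have bij: "bij f" if "f \<in> H" for f
    using that assms(1) subgroup.subset S_inf_carrier by blast
  have val: "term_val (perm_group H) s t \<in> H" for t
    using term_val_in_carrier[OF grp, of s] assms(2) by simp
  show ?thesis
  proof (induction t)
    case (GMul t u)
    then show ?case using val[of t] val[of u] bij by (simp add: S_inf_mult)
  next
    case (GInv t)
    then show ?case
      using val[of t] bij group.m_inv_consistent[OF group_BijGroup assms(1)] by (simp add: S_inf_inv)
  qed (simp_all add: S_inf_one)
qed

lemma matrix_sat_perm_group:
  assumes "subgroup H S_inf" "range s \<subseteq> H"
  shows "matrix_sat (perm_group H) s \<phi> \<longleftrightarrow> perm_sat s \<phi>"
  by (induction \<phi>) (simp_all add: term_val_perm_group[OF assms])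

text \<open>Needed to code an assignment by finitely many tables. The bound is phrased as eventual
  truth so that the bounds of subformulas combine by filter reasoning.\<close>

lemma perm_sat_finite_dependence:
  obtains K where "\<And>s s'. (\<And>v. v < K \<Longrightarrow> s v = s' v) \<Longrightarrow> perm_sat s \<phi> \<longleftrightarrow> perm_sat s' \<phi>"
proof -
  have tm: "\<forall>\<^sub>F K in sequentially. \<forall>s s'. (\<forall>v<K. s v = s' v) \<longrightarrow> perm_val s t = perm_val s' t" for t
  proof (induction t)
    case (GVar v)
    show ?case using eventually_gt_at_top[of v] by eventually_elim simp
  next
    case (GMul t u)
    then show ?case by eventually_elim (metis perm_val.simps(3))
  next
    case (GInv t)
    then show ?case by eventually_elim (metis perm_val.simps(4))
  qed simp
  have "\<forall>\<^sub>F K in sequentially. \<forall>s s'. (\<forall>v<K. s v = s' v) \<longrightarrow> perm_sat s \<phi> = perm_sat s' \<phi>"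
  proof (induction \<phi>)
    case (GEq t u)
    show ?case using tm[of t] tm[of u] by eventually_elim (metis perm_sat.simps(1))
  next
    case (GNeg \<phi>)
    then show ?case by eventually_elim (metis perm_sat.simps(2))
  next
    case (GAnd \<phi> \<psi>)
    then show ?case by eventually_elim (metis perm_sat.simps(3))
  next
    case (GOr \<phi> \<psi>)
    then show ?case by eventually_elim (metis perm_sat.simps(4))
  qed simp_all
  then show ?thesis using that eventually_happens'[OF sequentially_bot] by blast
qed


section \<open>Permutations agreeing on each orbit with a group element\<close>

definition orbitwise :: "(nat \<Rightarrow> nat) set \<Rightarrow> (nat \<Rightarrow> nat) set" where
  "orbitwise G = {p. \<forall>x. \<exists>g\<in>G. \<forall>y\<in>orb G x. p y = g y}"

locale finite_orbits =
  fixes G :: "(nat \<Rightarrow> nat) set"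
  assumes subgroup_G: "subgroup G S_inf" and finite_orb: "finite (orb G n)"
begin

lemma bij_G: "g \<in> G \<Longrightarrow> bij g"
  using subgroup_G subgroup.subset S_inf_carrier by blast

lemma id_in_G: "id \<in> G"
  using subgroup.one_closed[OF subgroup_G] by (simp add: S_inf_one)

lemma comp_in_G: "f \<in> G \<Longrightarrow> g \<in> G \<Longrightarrow> f \<circ> g \<in> G"
  using subgroup.m_closed[OF subgroup_G] bij_G by (metis S_inf_mult)

lemma inv_in_G: "g \<in> G \<Longrightarrow> pinv g \<in> G"
  using subgroup.m_inv_closed[OF subgroup_G] bij_G by (metis S_inf_inv)

lemma orb_self: "x \<in> orb G x"
  unfolding orb_def using id_in_G by (intro CollectI exI[of _ id]) simp

lemma G_maps_orb:
  assumes "g \<in> G" "y \<in> orb G x"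
  shows "g y \<in> orb G x"
proof -
  obtain h where "h \<in> G" "y = h x" using assms(2) by (auto simp: orb_def)
  then show ?thesis
    unfolding orb_def using comp_in_G[OF assms(1)] by (intro CollectI exI[of _ "g \<circ> h"]) simp
qed

lemma orb_eq: "y \<in> orb G x \<Longrightarrow> orb G y = orb G x"
proof -
  have sub: "orb G y \<subseteq> orb G x" if "y \<in> orb G x" for x y
    using G_maps_orb[OF _ that] by (auto simp: orb_def[of G y])
  assume y: "y \<in> orb G x"
  then obtain g where g: "g \<in> G" "y = g x" by (auto simp: orb_def)
  then have "x = pinv g y" using bij_G by (metis bij_inv_eq_iff)
  then have "x \<in> orb G y" using inv_in_G g by (auto simp: orb_def)
  then show ?thesis using sub y by blast
qed

lemma orbitwiseE:
  assumes "p \<in> orbitwise G"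
  obtains g where "g \<in> G" "\<And>y. y \<in> orb G x \<Longrightarrow> p y = g y"
  using assms unfolding orbitwise_def by blast

lemma orbitwise_maps_orb: "p \<in> orbitwise G \<Longrightarrow> y \<in> orb G x \<Longrightarrow> p y \<in> orb G x"
  by (metis orbitwiseE G_maps_orb)

text \<open>Orbits partition the naturals, and on each one \<open>p\<close> acts as an element of
  \<open>G\<close>, hence as a bijection of that orbit.\<close>

lemma bij_orbitwise:
  assumes p: "p \<in> orbitwise G"
  shows "bij p"
proof (rule bijI)
  show "inj p"
  proof (rule injI)
    fix a b assume ab: "p a = p b"
    then have "orb G a = orb G b"
      using orbitwise_maps_orb[OF p orb_self] orb_eq by metis
    moreover obtain g where "g \<in> G" "\<And>y. y \<in> orb G a \<Longrightarrow> p y = g y"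
      using p orbitwiseE by blast
    ultimately show "a = b" using ab orb_self bij_G by (metis bij_pointE)
  qed
  have "\<exists>x. p x = y" for y
  proof -
    obtain g where g: "g \<in> G" "\<And>z. z \<in> orb G y \<Longrightarrow> p z = g z"
      using p orbitwiseE by blast
    have "pinv g y \<in> orb G y" using G_maps_orb[OF inv_in_G[OF g(1)] orb_self] .
    then show ?thesis using g bij_G by (metis bij_inv_eq_iff)
  qed
  then show "surj p" by (metis surjI)
qed

lemma comp_orbitwise:
  assumes p: "p \<in> orbitwise G" and q: "q \<in> orbitwise G"
  shows "p \<circ> q \<in> orbitwise G"
proof -
  have "\<exists>g\<in>G. \<forall>y\<in>orb G x. (p \<circ> q) y = g y" for x
  proof -
    obtain g where g: "g \<in> G" "\<And>y. y \<in> orb G x \<Longrightarrow> p y = g y" using p orbitwiseE by blast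
    obtain h where h: "h \<in> G" "\<And>y. y \<in> orb G x \<Longrightarrow> q y = h y" using q orbitwiseE by blast
    have "\<forall>y\<in>orb G x. (p \<circ> q) y = (g \<circ> h) y"
      using g h G_maps_orb by simp
    then show ?thesis using comp_in_G g h by blast
  qed
  then show ?thesis unfolding orbitwise_def by blast
qed

lemma inv_orbitwise:
  assumes p: "p \<in> orbitwise G"
  shows "pinv p \<in> orbitwise G"
proof -
  have "\<exists>g\<in>G. \<forall>y\<in>orb G x. pinv p y = g y" for x
  proof -
    obtain g where g: "g \<in> G" "\<And>y. y \<in> orb G x \<Longrightarrow> p y = g y" using p orbitwiseE by blast
    have "pinv p y = pinv g y" if "y \<in> orb G x" for y
    proof -
      have "p (pinv g y) = g (pinv g y)" using g G_maps_orb inv_in_G that by blast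
      also have "\<dots> = y" using bij_G[OF g(1)] by (simp add: bij_is_surj surj_f_inv_f)
      finally show ?thesis using bij_orbitwise[OF p] by (metis bij_inv_eq_iff)
    qed
    then show ?thesis using inv_in_G g(1) by blast
  qed
  then show ?thesis by (simp add: orbitwise_def)
qed

lemma id_orbitwise: "id \<in> orbitwise G"
  using id_in_G unfolding orbitwise_def by blast

lemma subgroup_orbitwise: "subgroup (orbitwise G) S_inf"
proof (rule group.subgroupI[OF group_BijGroup])
  show "orbitwise G \<subseteq> carrier S_inf" using bij_orbitwise S_inf_carrier by blast
  show "orbitwise G \<noteq> {}" using id_orbitwise by blast
qed (simp_all add: S_inf_inv S_inf_mult bij_orbitwise inv_orbitwise comp_orbitwise)

section \<open>The enumerated orbits and the product of the orbit groups\<close>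

lemma orbit_enum_is_orb: "\<exists>x. orbit_enum G k = orb G x"
  by (cases k) auto

text \<open>If \<open>Suc n\<close> is still missing, the induction hypothesis makes it the least
  missing number, so its orbit comes next.\<close>

lemma orbit_enum_covers: "{..n} \<subseteq> (\<Union>m\<in>{..n}. orbit_enum G m)"
proof (induction n)
  case 0 then show ?case using orb_self by auto
next
  case (Suc n)
  show ?case
  proof (cases "Suc n \<in> (\<Union>m\<in>{..n}. orbit_enum G m)")
    case True
    then show ?thesis using Suc by (auto simp: atMost_Suc)
  next
    case False
    then have "(LEAST x. x \<notin> (\<Union>m\<in>{..n}. orbit_enum G m)) = Suc n"
      using Suc by (intro Least_equality) (auto simp: not_less_eq_eq[symmetric])
    then have "orbit_enum G (Suc n) = orb G (Suc n)" by simp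
    then show ?thesis using Suc orb_self[of "Suc n"] by (auto simp: atMost_Suc)
  qed
qed

lemma orbit_enum_inj:
  assumes "y \<in> orbit_enum G j" "y \<in> orbit_enum G k"
  shows "j = k"
proof -
  have False if "j < k" "y \<in> orbit_enum G j" "y \<in> orbit_enum G k" for j k
  proof -
    obtain n where n: "k = Suc n" using \<open>j < k\<close> by (cases k) auto
    define U where "U = (\<Union>m\<in>{..n}. orbit_enum G m)"
    define x where "x = (LEAST x. x \<notin> U)"
    \<comment> \<open>Finitely many finite orbits leave a number out, so \<open>LEAST\<close> really
      names a point outside all earlier orbits.\<close>
    have "finite U" unfolding U_def using orbit_enum_is_orb finite_orb by (metis finite_UN finite_atMost)
    then have "\<exists>x. x \<notin> U" using ex_new_if_finite infinite_UNIV_nat by blast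
    then have "x \<notin> U" unfolding x_def by (rule LeastI_ex)
    moreover have "orbit_enum G k = orb G x" by (simp add: n x_def U_def)
    moreover obtain z where "orbit_enum G j = orb G z" using orbit_enum_is_orb by blast
    ultimately have "x \<in> orbit_enum G j" using that orb_eq orb_self by metis
    with \<open>x \<notin> U\<close> show False using \<open>j < k\<close> n by (auto simp: U_def)
  qed
  then show ?thesis using assms by (metis linorder_neqE_nat)
qed

text \<open>The isomorphism restricts a permutation to every orbit. The orbits cover, so nothing is
  lost; they are disjoint, so arbitrary components glue.\<close>

lemma orbitwise_iso_product: "perm_group (orbitwise G) \<cong> product_group UNIV (orbit_group G)"
proof -
  define \<Psi> where "\<Psi> p = (\<lambda>k. restrict p (orbit_enum G k))" for p :: "nat \<Rightarrow> nat"
  have maps: "p y \<in> orbit_enum G k" if "p \<in> orbitwise G" "y \<in> orbit_enum G k" for p k y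
    using that orbit_enum_is_orb orbitwise_maps_orb by metis
  have bij_betw: "bij_betw p (orbit_enum G k) (orbit_enum G k)" if p: "p \<in> orbitwise G" for p k
  proof (rule bij_betw_imageI)
    show inj: "inj_on p (orbit_enum G k)"
      using bij_orbitwise[OF p] by (meson bij_def inj_on_subset subset_UNIV)
    have "finite (orbit_enum G k)" using orbit_enum_is_orb finite_orb by metis
    then show "p ` orbit_enum G k = orbit_enum G k"
      using maps[OF p] inj by (intro endo_inj_surj) auto
  qed
  have Bij: "\<Psi> p k \<in> Bij (orbit_enum G k)" if "p \<in> orbitwise G" for p k
    using bij_betw[OF that, of k] by (simp add: \<Psi>_def Bij_def)
  have "\<Psi> \<in> iso (perm_group (orbitwise G)) (product_group UNIV (orbit_group G))"
  proof (rule isoI)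
    show hom: "\<Psi> \<in> hom (perm_group (orbitwise G)) (product_group UNIV (orbit_group G))"
    proof (rule homI)
      fix p assume "p \<in> carrier (perm_group (orbitwise G))"
      then have p: "p \<in> orbitwise G" by simp
      have "\<exists>g\<in>G. \<Psi> p k = restrict g (orbit_enum G k)" for k
      proof -
        obtain x where "orbit_enum G k = orb G x" using orbit_enum_is_orb by blast
        then show ?thesis using orbitwiseE[OF p, of x] by (metis \<Psi>_def restrict_ext)
      qed
      then show "\<Psi> p \<in> carrier (product_group UNIV (orbit_group G))"
        by (auto simp: orbit_group_def)
    next
      fix p q
      assume "p \<in> carrier (perm_group (orbitwise G))" "q \<in> carrier (perm_group (orbitwise G))"
      then have pq: "p \<in> orbitwise G" "q \<in> orbitwise G" by auto
      have "restrict (p \<circ> q) (orbit_enum G k) = compose (orbit_enum G k) (\<Psi> p k) (\<Psi> q k)" for k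
        using maps[OF pq(2)] by (auto simp: \<Psi>_def compose_def restrict_def)
      then show "\<Psi> (p \<otimes>\<^bsub>perm_group (orbitwise G)\<^esub> q) =
          \<Psi> p \<otimes>\<^bsub>product_group UNIV (orbit_group G)\<^esub> \<Psi> q"
        using Bij[OF pq(1)] Bij[OF pq(2)] S_inf_mult[OF bij_orbitwise[OF pq(1)] bij_orbitwise[OF pq(2)]]
        by (simp add: product_group_def orbit_group_def) (simp add: BijGroup_def \<Psi>_def fun_eq_iff)
    qed
    show "bij_betw \<Psi> (carrier (perm_group (orbitwise G))) (carrier (product_group UNIV (orbit_group G)))"
    proof (rule bij_betw_imageI)
      show "inj_on \<Psi> (carrier (perm_group (orbitwise G)))"
      proof (rule inj_onI, rule ext)
        fix p q x assume "\<Psi> p = \<Psi> q"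
        moreover obtain k where "x \<in> orbit_enum G k" using orbit_enum_covers[of x] by auto
        ultimately show "p x = q x" unfolding \<Psi>_def by (metis restrict_apply')
      qed
      have "f \<in> \<Psi> ` orbitwise G" if f: "f \<in> carrier (product_group UNIV (orbit_group G))" for f
      proof -
        have "\<exists>g\<in>G. f k = restrict g (orbit_enum G k)" for k
          using f by (auto simp: orbit_group_def PiE_def Pi_def)
        then obtain g where g: "\<And>k. g k \<in> G" "\<And>k. f k = restrict (g k) (orbit_enum G k)"
          by metis
        \<comment> \<open>\<open>\<kappa> x\<close> is the index of the orbit of \<open>x\<close>,
          and the glued permutation uses there the representative chosen for that index.\<close>
        define \<kappa> where "\<kappa> x = (THE k. x \<in> orbit_enum G k)" for x
        have \<kappa>: "\<kappa> x = k" if "x \<in> orbit_enum G k" for x k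
          unfolding \<kappa>_def using that orbit_enum_inj by blast
        define p where "p x = g (\<kappa> x) x" for x
        have "\<exists>g\<in>G. \<forall>y\<in>orb G x. p y = g y" for x
        proof -
          obtain k where k: "x \<in> orbit_enum G k" using orbit_enum_covers[of x] by auto
          then have "orbit_enum G k = orb G x" using orbit_enum_is_orb orb_eq by metis
          then show ?thesis using \<kappa> g(1) by (metis p_def)
        qed
        then have "p \<in> orbitwise G" by (simp add: orbitwise_def)
        moreover have "f = \<Psi> p" using \<kappa> g(2) by (auto simp: \<Psi>_def fun_eq_iff restrict_def p_def)
        ultimately show ?thesis by blast
      qed
      moreover have "\<Psi> ` orbitwise G \<subseteq> carrier (product_group UNIV (orbit_group G))"
        using hom_in_carrier[OF hom] by fastforce
      ultimately show "\<Psi> ` carrier (perm_group (orbitwise G)) =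
          carrier (product_group UNIV (orbit_group G))"
        by auto
    qed
  qed
  then show ?thesis by (auto simp: is_iso_def)
qed

text \<open>Both \<open>G\<close> and \<open>orbitwise G\<close> are isomorphic to the product of
  the orbit groups, one by hypothesis and one by restriction.\<close>

lemma true_in_iff_perm_sat:
  assumes "orbit_independent G" "existential \<phi>" "free_vars \<phi> = {}"
  shows "true_in (perm_group G) \<phi> \<longleftrightarrow> (\<exists>s. range s \<subseteq> orbitwise G \<and> perm_sat s \<phi>)"
proof -
  have grp: "group (perm_group H)" if "subgroup H S_inf" for H
    using that subgroup.subgroup_is_group[OF _ group_BijGroup] by blast
  have "perm_group G \<cong> perm_group (orbitwise G)"
    using assms(1) orbitwise_iso_product group.iso_sym[OF grp[OF subgroup_orbitwise]] iso_trans
    unfolding orbit_independent_def by blast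
  then have "true_in (perm_group G) \<phi> \<longleftrightarrow> true_in (perm_group (orbitwise G)) \<phi>"
    using true_in_existential_iso[OF assms(2,3) grp grp] subgroup_G subgroup_orbitwise by blast
  also have "\<dots> \<longleftrightarrow> (\<exists>s. range s \<subseteq> orbitwise G \<and> perm_sat s \<phi>)"
    using true_in_existential_iff[OF assms(2,3) grp[OF subgroup_orbitwise]]
      matrix_sat_perm_group[OF subgroup_orbitwise] by auto
  finally show ?thesis .
qed

section \<open>Truncation to unions of orbits\<close>

lemma perm_val_orbitwise: "range s \<subseteq> orbitwise G \<Longrightarrow> perm_val s t \<in> orbitwise G"
  by (induction t) (auto simp: id_orbitwise comp_orbitwise inv_orbitwise)

text \<open>For a union \<open>D\<close> of orbits, truncation is the projection to the factors with
  orbits inside \<open>D\<close>, padded with identities. It is a homomorphism and so commutes with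
  words.\<close>

lemma perm_val_truncate:
  assumes s: "range s \<subseteq> orbitwise G" and D: "\<And>x. x \<in> D \<Longrightarrow> orb G x \<subseteq> D"
  shows "perm_val (\<lambda>v x. if x \<in> D then s v x else x) t = (\<lambda>x. if x \<in> D then perm_val s t x else x)"
proof -
  have maps: "p x \<in> D" if "p \<in> orbitwise G" "x \<in> D" for p x
    using that D orbitwise_maps_orb[OF _ orb_self] by blast
  show ?thesis
  proof (induction t)
    case (GMul t u)
    then show ?case using maps perm_val_orbitwise[OF s] by (auto simp: fun_eq_iff)
  next
    case (GInv t)
    let ?p = "perm_val s t"
    have p: "?p \<in> orbitwise G" using perm_val_orbitwise[OF s] .
    have "pinv (\<lambda>x. if x \<in> D then ?p x else x) = (\<lambda>x. if x \<in> D then pinv ?p x else x)"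
    proof (rule inv_equality)
      fix x
      show "(if (if x \<in> D then ?p x else x) \<in> D then pinv ?p (if x \<in> D then ?p x else x)
          else (if x \<in> D then ?p x else x)) = x"
        using maps[OF p] bij_orbitwise[OF p] by (simp add: bij_is_inj)
      show "(if (if x \<in> D then pinv ?p x else x) \<in> D then ?p (if x \<in> D then pinv ?p x else x)
          else (if x \<in> D then pinv ?p x else x)) = x"
        using maps[OF inv_orbitwise[OF p]] bij_orbitwise[OF p] by (simp add: bij_is_surj surj_f_inv_f)
    qed
    then show ?case by (simp only: perm_val.simps GInv)
  qed auto
qed

text \<open>An equation failing under \<open>s\<close> already fails at a single point, so the finitely many atoms of
  \<open>\<phi>\<close> keep their truth values on a finite union of orbits.\<close>

lemma perm_sat_truncate:
  assumes s: "range s \<subseteq> orbitwise G"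
  shows "\<exists>E. finite E \<and> (\<forall>D. E \<subseteq> D \<longrightarrow> (\<forall>x\<in>D. orb G x \<subseteq> D) \<longrightarrow>
    (perm_sat (\<lambda>v x. if x \<in> D then s v x else x) \<phi> \<longleftrightarrow> perm_sat s \<phi>))"
proof -
  define s' where "s' D = (\<lambda>v x. if x \<in> D then s v x else x)" for D
  define inv_set where "inv_set D \<longleftrightarrow> (\<forall>x\<in>D. orb G x \<subseteq> D)" for D
  define Q where "Q \<phi> D \<longleftrightarrow> (inv_set D \<longrightarrow> (perm_sat (s' D) \<phi> \<longleftrightarrow> perm_sat s \<phi>))" for \<phi> D
  have val: "perm_val (s' D) t x = (if x \<in> D then perm_val s t x else x)" if "inv_set D" for D t x
    using perm_val_truncate[OF s, of D t] that by (simp add: s'_def inv_set_def)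
  have Un: "\<exists>E. finite E \<and> (\<forall>D. E \<subseteq> D \<longrightarrow> Q \<phi> D \<and> Q \<psi> D)"
    if "\<exists>E. finite E \<and> (\<forall>D. E \<subseteq> D \<longrightarrow> Q \<phi> D)" "\<exists>E. finite E \<and> (\<forall>D. E \<subseteq> D \<longrightarrow> Q \<psi> D)" for \<phi> \<psi>
    using that by (metis finite_Un le_sup_iff)
  have "\<exists>E. finite E \<and> (\<forall>D. E \<subseteq> D \<longrightarrow> Q \<phi> D)"
  proof (induction \<phi>)
    case (GEq t u)
    show ?case
    proof (cases "perm_val s t = perm_val s u")
      case True
      \<comment> \<open>An equation that holds survives truncation to any invariant set, so no point
        has to be protected.\<close>
      then show ?thesis by (intro exI[of _ "{}"]) (auto simp: Q_def val)
    next
      case False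
      then obtain x where "perm_val s t x \<noteq> perm_val s u x" by auto
      then have "Q (GEq t u) D" if "{x} \<subseteq> D" for D
      proof -
        have "perm_val (s' D) t \<noteq> perm_val (s' D) u" if "inv_set D"
          using val[OF that, of _ x] \<open>{x} \<subseteq> D\<close> \<open>perm_val s t x \<noteq> perm_val s u x\<close>
          by (metis insert_subset)
        with False show ?thesis by (simp add: Q_def)
      qed
      then show ?thesis by blast
    qed
  next
    case (GAnd \<phi> \<psi>)
    from Un[OF this] obtain E where "finite E" "\<And>D. E \<subseteq> D \<Longrightarrow> Q \<phi> D \<and> Q \<psi> D" by blast
    then show ?case by (intro exI[of _ E]) (simp add: Q_def)
  next
    case (GOr \<phi> \<psi>)
    from Un[OF this] obtain E where "finite E" "\<And>D. E \<subseteq> D \<Longrightarrow> Q \<phi> D \<and> Q \<psi> D" by blast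
    then show ?case by (intro exI[of _ E]) (simp add: Q_def)
  qed (auto simp: Q_def)
  then show ?thesis by (simp add: Q_def inv_set_def s'_def)
qed

lemma perm_sat_finite_support:
  assumes s: "range s \<subseteq> orbitwise G" "perm_sat s \<phi>"
  obtains s' M where "range s' \<subseteq> orbitwise G" "\<And>v x. x \<ge> M \<Longrightarrow> s' v x = x" "perm_sat s' \<phi>"
proof -
  obtain E where E: "finite E" "\<And>D. E \<subseteq> D \<Longrightarrow> \<forall>x\<in>D. orb G x \<subseteq> D \<Longrightarrow>
      perm_sat (\<lambda>v x. if x \<in> D then s v x else x) \<phi> \<longleftrightarrow> perm_sat s \<phi>"
    using perm_sat_truncate[OF s(1), of \<phi>] by blast
  \<comment> \<open>Closing \<open>E\<close> under \<open>G\<close> keeps it finite, because each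
    orbit is finite.\<close>
  define D where "D = (\<Union>x\<in>E. orb G x)"
  define s' where "s' v x = (if x \<in> D then s v x else x)" for v x
  have closed: "\<forall>x\<in>D. orb G x \<subseteq> D" unfolding D_def using orb_eq by blast
  have "finite D" using E(1) finite_orb by (auto simp: D_def)
  then obtain M where "\<forall>x\<in>D. x < M" using finite_nat_set_iff_bounded by auto
  then have "s' v x = x" if "x \<ge> M" for v x using that by (force simp: s'_def)
  moreover have "perm_sat s' \<phi>"
    using E(2)[OF _ closed] s(2) orb_self by (auto simp: D_def s'_def[abs_def])
  moreover have "s' v \<in> orbitwise G" for v
  proof -
    \<comment> \<open>An orbit lies inside \<open>D\<close> or misses it; in the second case the
      identity of \<open>G\<close> serves as witness.\<close>
    have "\<exists>g\<in>G. \<forall>y\<in>orb G x. s' v y = g y" for x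
    proof (cases "x \<in> D")
      case True
      then have "\<forall>y\<in>orb G x. s' v y = s v y" using closed by (auto simp: s'_def)
      then show ?thesis using s(1) orbitwiseE[of "s v" x] by (metis range_subsetD)
    next
      case False
      then have "\<forall>y\<in>orb G x. s' v y = id y"
        using closed orb_eq orb_self by (force simp: s'_def)
      then show ?thesis using id_in_G by blast
    qed
    then show ?thesis by (simp add: orbitwise_def)
  qed
  ultimately show ?thesis using that by blast
qed

end


section \<open>Syntax on codes\<close>

lemma code_rec_leaf [simp]: "code_rec g a (prod_encode (0, m)) = g a 0 m 0 0 0"
  by (subst code_rec.simps) simp

lemma code_rec_node [simp]:
  "t \<noteq> 0 \<Longrightarrow> code_rec g a (prod_encode (t, m)) =
    g a t m (code_rec g a m) (code_rec g a (pfst m)) (code_rec g a (psnd m))"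
  by (subst code_rec.simps) simp

lemma code_induct [case_names leaf node]:
  assumes "\<And>m. P (prod_encode (0, m))"
    and "\<And>t m. t \<noteq> 0 \<Longrightarrow> P m \<Longrightarrow> P (pfst m) \<Longrightarrow> P (psnd m) \<Longrightarrow> P (prod_encode (t, m))"
  shows "P n"
proof (induction n rule: less_induct)
  case (less n)
  have n: "n = prod_encode (pfst n, psnd n)" by simp
  show ?case
  proof (cases "pfst n = 0")
    case True
    then show ?thesis using assms(1) n by metis
  next
    case False
    then show ?thesis
      using assms(2)[OF False, of "psnd n"] less psnd_less[OF False]
        le_less_trans[OF pfst_le psnd_less[OF False]] le_less_trans[OF psnd_le psnd_less[OF False]]
      by simp
  qed
qed

lemma of_bool_eq_Suc_0_iff [simp]: "of_bool P = Suc 0 \<longleftrightarrow> P"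
  by (cases P) auto

text \<open>In the step functions for codes, \<open>x\<close>, \<open>y\<close> and \<open>z\<close>
  are the recursive values at \<open>m\<close>, \<open>pfst m\<close> and \<open>psnd m\<close>: a
  unary node reads \<open>x\<close>, a binary one \<open>y\<close> and \<open>z\<close>. Value 1
  means yes.\<close>

definition is_term_code :: "nat \<Rightarrow> nat" where
  "is_term_code = code_rec (\<lambda>a t m x y z.
     if t = 0 then 1 else if t = 1 then of_bool (m = 0)
     else if t = 2 then of_bool (y = 1 \<and> z = 1) else if t = 3 then x else 0) 0"

lemma is_term_code_pair: "is_term_code (prod_encode (t, m)) =
    (if t = 0 then 1 else if t = 1 then of_bool (m = 0)
     else if t = 2 then of_bool (is_term_code (pfst m) = 1 \<and> is_term_code (psnd m) = 1)
     else if t = 3 then is_term_code m else 0)"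
  unfolding is_term_code_def by (cases "t = 0") simp_all

lemma is_term_code_iff: "is_term_code n = 1 \<longleftrightarrow> n \<in> range term_encode"
proof
  show "n \<in> range term_encode" if "is_term_code n = 1"
    using that
  proof (induction n rule: code_induct)
    case (leaf m)
    then show ?case by (intro range_eqI[of _ _ "GVar m"]) simp
  next
    case (node t m)
    from node.prems \<open>t \<noteq> 0\<close> consider "t = 1" "m = 0"
      | "t = 2" "is_term_code (pfst m) = 1" "is_term_code (psnd m) = 1"
      | "t = 3" "is_term_code m = 1"
      by (auto simp: is_term_code_pair split: if_splits)
    then show ?case
    proof cases
      case 1
      then show ?thesis by (intro range_eqI[of _ _ GOne]) simp
    next
      case 2
      then obtain u v where "pfst m = term_encode u" "psnd m = term_encode v"
        using node.IH by blast
      then have "m = prod_encode (term_encode u, term_encode v)" by (metis prod.collapse prod_decode_inverse)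
      then show ?thesis using 2 by (intro range_eqI[of _ _ "GMul u v"]) simp
    next
      case 3
      then obtain u where "m = term_encode u" using node.IH by blast
      then show ?thesis using 3 by (intro range_eqI[of _ _ "GInv u"]) simp
    qed
  qed
  have "is_term_code (term_encode t) = 1" for t
    by (induction t) (auto simp: is_term_code_pair)
  then show "n \<in> range term_encode \<Longrightarrow> is_term_code n = 1" by auto
qed

text \<open>\<open>2\<close> for quantifier-free formulas, \<open>1\<close> for the other existential ones.\<close>

definition form_kind :: "nat \<Rightarrow> nat" where
  "form_kind = code_rec (\<lambda>a t m x y z.
     if t = 0 then (if is_term_code (pfst m) = 1 \<and> is_term_code (psnd m) = 1 then 2 else 0)
     else if t = 1 then (if x = 2 then 2 else 0)
     else if t = 2 \<or> t = 3 then (if y = 2 \<and> z = 2 then 2 else 0)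
     else if t = 4 \<and> 0 < z then 1 else 0) 0"

lemma form_kind_pair: "form_kind (prod_encode (t, m)) =
    (if t = 0 then (if is_term_code (pfst m) = 1 \<and> is_term_code (psnd m) = 1 then 2 else 0)
     else if t = 1 then (if form_kind m = 2 then 2 else 0)
     else if t = 2 \<or> t = 3 then (if form_kind (pfst m) = 2 \<and> form_kind (psnd m) = 2 then 2 else 0)
     else if t = 4 \<and> 0 < form_kind (psnd m) then 1 else 0)"
  unfolding form_kind_def by (cases "t = 0") simp_all

lemma existential_simps:
  "existential (GEq t u)"
  "existential (GNeg \<phi>) \<longleftrightarrow> quantifier_free \<phi>"
  "existential (GAnd \<phi> \<psi>) \<longleftrightarrow> quantifier_free \<phi> \<and> quantifier_free \<psi>"
  "existential (GOr \<phi> \<psi>) \<longleftrightarrow> quantifier_free \<phi> \<and> quantifier_free \<psi>"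
  "existential (GEx v \<phi>) \<longleftrightarrow> existential \<phi>"
  "\<not> existential (GAll v \<phi>)"
  by (auto simp: existential.simps[of "GEq t u"] existential.simps[of "GNeg \<phi>"]
      existential.simps[of "GAnd \<phi> \<psi>"] existential.simps[of "GOr \<phi> \<psi>"]
      existential.simps[of "GEx v \<phi>"] existential.simps[of "GAll v \<phi>"])

lemma form_kind_form_encode:
  "form_kind (form_encode \<phi>) = (if quantifier_free \<phi> then 2 else of_bool (existential \<phi>))"
proof (induction \<phi>)
  case (GEq t u)
  have "is_term_code (term_encode t) = 1" "is_term_code (term_encode u) = 1"
    using is_term_code_iff by blast+
  then show ?case by (simp add: form_kind_pair)
next
  case (GEx v \<phi>)
  then show ?case using existential.intros(1)[of \<phi>] by (auto simp: form_kind_pair existential_simps)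
qed (auto simp: form_kind_pair existential_simps)

lemma form_kind_imp_code: "form_kind n \<noteq> 0 \<Longrightarrow> n \<in> range form_encode"
proof (induction n rule: code_induct)
  case (leaf m)
  then have "is_term_code (pfst m) = 1" "is_term_code (psnd m) = 1"
    by (auto simp: form_kind_pair split: if_splits)
  then obtain t u where "pfst m = term_encode t" "psnd m = term_encode u"
    using is_term_code_iff by blast
  then have "m = prod_encode (term_encode t, term_encode u)" by (metis prod.collapse prod_decode_inverse)
  then show ?case by (intro range_eqI[of _ _ "GEq t u"]) simp
next
  case (node t m)
  from node.prems \<open>t \<noteq> 0\<close> consider "t = 1" "form_kind m \<noteq> 0"
    | "t = 2 \<or> t = 3" "form_kind (pfst m) \<noteq> 0" "form_kind (psnd m) \<noteq> 0"
    | "t = 4" "form_kind (psnd m) \<noteq> 0"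
    by (auto simp: form_kind_pair split: if_splits)
  then show ?case
  proof cases
    case 1
    then obtain \<phi> where "m = form_encode \<phi>" using node.IH by blast
    then show ?thesis using 1 by (intro range_eqI[of _ _ "GNeg \<phi>"]) simp
  next
    case 2
    then obtain \<phi> \<psi> where "pfst m = form_encode \<phi>" "psnd m = form_encode \<psi>"
      using node.IH by blast
    then have "m = prod_encode (form_encode \<phi>, form_encode \<psi>)" by (metis prod.collapse prod_decode_inverse)
    then have "prod_encode (2, m) = form_encode (GAnd \<phi> \<psi>)" "prod_encode (3, m) = form_encode (GOr \<phi> \<psi>)"
      by simp_all
    then show ?thesis using 2 by blast
  next
    case 3
    then obtain \<phi> where "psnd m = form_encode \<phi>" using node.IH by blast
    then have "m = prod_encode (pfst m, form_encode \<phi>)" by (metis prod.collapse prod_decode_inverse)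
    then show ?thesis using 3 by (intro range_eqI[of _ _ "GEx (pfst m) \<phi>"]) simp
  qed
qed

definition occurs_in_term :: "nat \<Rightarrow> nat \<Rightarrow> nat" where
  "occurs_in_term = code_rec (\<lambda>a t m x y z.
     if t = 0 then of_bool (m = a) else if t = 2 then of_bool (y = 1 \<or> z = 1)
     else if t = 3 then x else 0)"

lemma occurs_in_term_encode: "occurs_in_term v (term_encode t) = of_bool (v \<in> term_vars t)"
  by (induction t) (auto simp: occurs_in_term_def)

text \<open>Equations carry tag 0 and are thus leaves of the recursion on formulas; their two terms
  are treated by the separate recursion on terms. The last line covers both quantifiers, with
  \<open>pfst m\<close> the bound variable.\<close>

definition occurs_free :: "nat \<Rightarrow> nat \<Rightarrow> nat" where
  "occurs_free = code_rec (\<lambda>a t m x y z.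
     if t = 0 then of_bool (occurs_in_term a (pfst m) = 1 \<or> occurs_in_term a (psnd m) = 1)
     else if t = 1 then x else if t = 2 \<or> t = 3 then of_bool (y = 1 \<or> z = 1)
     else of_bool (z = 1 \<and> a \<noteq> pfst m))"

lemma occurs_free_encode: "occurs_free v (form_encode \<phi>) = of_bool (v \<in> free_vars \<phi>)"
  by (induction \<phi>) (auto simp: occurs_free_def occurs_in_term_encode)

lemma le_prod_encodeI1: "v \<le> a \<Longrightarrow> v \<le> prod_encode (a, b)"
  using le_prod_encode_1 order.trans by blast

lemma le_prod_encodeI2: "v \<le> b \<Longrightarrow> v \<le> prod_encode (a, b)"
  using le_prod_encode_2 order.trans by blast

lemma term_vars_le_encode: "v \<in> term_vars t \<Longrightarrow> v \<le> term_encode t"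
  by (induction t) (auto intro: le_prod_encodeI1 le_prod_encodeI2)

lemma free_vars_le_encode: "v \<in> free_vars \<phi> \<Longrightarrow> v \<le> form_encode \<phi>"
  by (induction \<phi>)
    (auto intro: le_prod_encodeI1 le_prod_encodeI2 dest!: term_vars_le_encode)

text \<open>The code bounds every free variable, so closedness is a bounded and hence decidable
  check.\<close>

lemma closed_iff_occurs_free:
  "free_vars \<phi> = {} \<longleftrightarrow> (\<forall>v<Suc (form_encode \<phi>). occurs_free v (form_encode \<phi>) \<noteq> 1)"
  using free_vars_le_encode[of _ \<phi>] by (auto simp: occurs_free_encode less_Suc_eq_le)


section \<open>Evaluation under coded assignments of finitely supported permutations\<close>

text \<open>\<open>prod_encode (M, prod_encode (K, c))\<close> codes an assignment which is the identity on all
  variables from \<open>K\<close> on and all points from \<open>M\<close> on; \<open>c\<close> codes the remaining table.\<close>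

definition assignment :: "nat \<Rightarrow> nat \<Rightarrow> nat \<Rightarrow> nat" where
  "assignment w v y = (if v < pfst (psnd w) \<and> y < pfst w
     then code_nth (code_nth (psnd (psnd w)) v) y else y)"

text \<open>Each subterm is represented by its table below \<open>pfst w\<close>. Inverses are found
  by search in the table; the alternative \<open>j = pfst w\<close> ends the search even if the
  table is not a permutation.\<close>

definition term_table :: "nat \<Rightarrow> nat \<Rightarrow> nat" where
  "term_table = code_rec (\<lambda>w t m x y z. list_encode (map (\<lambda>i.
     if t = 0 then assignment w m i else if t = 1 then i
     else if t = 2 then code_nth y (code_nth z i)
     else (LEAST j. j = pfst w \<or> code_nth x j = i)) [0..<pfst w]))"

definition matrix_holds :: "nat \<Rightarrow> nat \<Rightarrow> nat" where
  "matrix_holds = code_rec (\<lambda>w t m x y z.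
     if t = 0 then of_bool (term_table w (pfst m) = term_table w (psnd m))
     else if t = 1 then 1 - x else if t = 2 then of_bool (y = 1 \<and> z = 1)
     else if t = 3 then of_bool (y = 1 \<or> z = 1) else if t = 4 then z else 0)"

text \<open>If \<open>p x \<ge> M\<close>, then \<open>p\<close> fixes \<open>p x\<close>, and
  injectivity gives \<open>p x = x\<close>.\<close>

lemma bij_maps_below:
  fixes p :: "nat \<Rightarrow> nat"
  assumes "bij p" "\<And>x. x \<ge> M \<Longrightarrow> p x = x" "x < M"
  shows "p x < M"
  using assms by (metis bij_pointE leD leI)

lemma perm_val_below:
  assumes "\<And>v. bij (s v)" "\<And>v x. x \<ge> M \<Longrightarrow> s v x = x"
  shows "bij (perm_val s t) \<and> (\<forall>x\<ge>M. perm_val s t x = x)"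
  using assms by (induction t) (auto simp: bij_comp bij_imp_bij_inv inv_f_eq bij_is_inj)

lemma term_table_encode:
  assumes bij: "\<And>v. bij (assignment w v)"
  shows "term_table w (term_encode t) = list_encode (map (perm_val (assignment w) t) [0..<pfst w])"
proof (induction t)
  case (GVar v)
  then show ?case by (simp add: term_table_def)
next
  case GOne
  then show ?case by (simp add: term_table_def)
next
  case (GMul t u)
  have "perm_val (assignment w) u i < pfst w" if "i < pfst w" for i
    using perm_val_below[OF bij, where M = "pfst w" and t = u] bij_maps_below that by (auto simp: assignment_def)
  with GMul show ?case
    by (auto simp: term_table_def code_nth_list_encode intro!: arg_cong[of _ _ list_encode])
next
  case (GInv t)
  let ?p = "perm_val (assignment w) t"
  have p: "bij ?p" "\<And>x. x \<ge> pfst w \<Longrightarrow> ?p x = x"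
    using perm_val_below[OF bij, where M = "pfst w" and t = t] by (auto simp: assignment_def)
  have "(LEAST j. j = pfst w \<or> code_nth (list_encode (map ?p [0..<pfst w])) j = i) = pinv ?p i"
    if i: "i < pfst w" for i
  proof (rule Least_equality)
    have p_inv: "?p (pinv ?p i) = i" using p(1) by (simp add: bij_is_surj surj_f_inv_f)
    \<comment> \<open>The preimage lies below \<open>pfst w\<close>, so the stopping alternative of
      the search never comes first.\<close>
    then have less: "pinv ?p i < pfst w" using p(2) i by (metis leI leD)
    then show "pinv ?p i = pfst w \<or> code_nth (list_encode (map ?p [0..<pfst w])) (pinv ?p i) = i"
      using p_inv by (simp add: code_nth_list_encode)
    fix j
    assume j: "j = pfst w \<or> code_nth (list_encode (map ?p [0..<pfst w])) j = i"
    show "pinv ?p i \<le> j"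
    proof (cases "j < pfst w")
      case True
      then have "?p j = i" using j by (simp add: code_nth_list_encode)
      then show ?thesis using p(1) by (simp add: bij_is_inj inv_f_eq)
    qed (use less in auto)
  qed
  with GInv show ?case
    by (auto simp: term_table_def intro!: arg_cong[of _ _ list_encode])
qed

lemma matrix_holds_encode:
  assumes bij: "\<And>v. bij (assignment w v)"
  shows "matrix_holds w (form_encode \<phi>) = of_bool (perm_sat (assignment w) \<phi>)"
proof (induction \<phi>)
  case (GEq t u)
  \<comment> \<open>Both sides are the identity from \<open>pfst w\<close> on, so equality of the
    finite tables is equality of permutations.\<close>
  have "perm_val (assignment w) r x = x" if "x \<ge> pfst w" for r x
    using perm_val_below[OF bij, where M = "pfst w" and t = r] that by (auto simp: assignment_def)
  then have "(\<forall>x<pfst w. perm_val (assignment w) t x = perm_val (assignment w) u x) \<longleftrightarrow>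
      perm_val (assignment w) t = perm_val (assignment w) u"
    by (metis ext leI)
  then show ?case
    by (simp add: matrix_holds_def term_table_encode[OF bij] list_encode_eq map_eq_conv Ball_def)
qed (auto simp: matrix_holds_def)

section \<open>Computability of the syntax checks and of the evaluation\<close>

lemma recursive_is_term_code [rec_intros]:
  "recursive_in A f \<Longrightarrow> recursive_in A (\<lambda>x. is_term_code (f x))"
  unfolding is_term_code_def by (intro rec_intros)

lemma recursive_form_kind [rec_intros]:
  "recursive_in A f \<Longrightarrow> recursive_in A (\<lambda>x. form_kind (f x))"
  unfolding form_kind_def by (intro rec_intros)

lemma recursive_occurs_in_term [rec_intros]:
  "recursive_in A f \<Longrightarrow> recursive_in A g \<Longrightarrow> recursive_in A (\<lambda>x. occurs_in_term (f x) (g x))"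
  unfolding occurs_in_term_def by (intro rec_intros)

lemma recursive_occurs_free [rec_intros]:
  "recursive_in A f \<Longrightarrow> recursive_in A g \<Longrightarrow> recursive_in A (\<lambda>x. occurs_free (f x) (g x))"
  unfolding occurs_free_def by (intro rec_intros)

lemma recursive_assignment [rec_intros]:
  "recursive_in A f \<Longrightarrow> recursive_in A g \<Longrightarrow> recursive_in A h \<Longrightarrow>
    recursive_in A (\<lambda>x. assignment (f x) (g x) (h x))"
  unfolding assignment_def by (intro rec_intros)

lemma recursive_term_table [rec_intros]:
  "recursive_in A f \<Longrightarrow> recursive_in A g \<Longrightarrow> recursive_in A (\<lambda>x. term_table (f x) (g x))"
  unfolding term_table_def by (intro rec_intros recursive_Least) auto

lemma recursive_matrix_holds [rec_intros]:
  "recursive_in A f \<Longrightarrow> recursive_in A g \<Longrightarrow> recursive_in A (\<lambda>x. matrix_holds (f x) (g x))"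
  unfolding matrix_holds_def by (intro rec_intros)


section \<open>Levels of the tree\<close>

lemma perm_string_0: "perm_string g 0 = [g 0, pinv g 0]"
  by (simp add: perm_string_def)

lemma perm_string_Suc: "perm_string g (Suc n) = perm_string g n @ [g (Suc n), pinv g (Suc n)]"
  by (simp add: perm_string_def)

lemma length_perm_string: "length (perm_string g n) = 2 * n + 2"
  by (induction n) (simp_all add: perm_string_0 perm_string_Suc)

lemma take_perm_string: "m \<le> n \<Longrightarrow> take (2 * m + 2) (perm_string g n) = perm_string g m"
proof (induction n)
  case 0
  then show ?case by (simp add: perm_string_0)
next
  case (Suc n)
  show ?case
  proof (cases "m = Suc n")
    case True
    then show ?thesis by (simp add: length_perm_string)
  next
    case False
    with Suc show ?thesis by (simp add: perm_string_Suc length_perm_string)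
  qed
qed

lemma perm_string_nth: "i \<le> n \<Longrightarrow> perm_string g n ! (2 * i) = g i"
proof (induction n)
  case 0
  then show ?case by (simp add: perm_string_0)
next
  case (Suc n)
  then show ?case
    by (cases "i = Suc n") (simp_all add: perm_string_Suc nth_append length_perm_string)
qed

lemma set_perm_string: "set (perm_string g n) = g ` {..n} \<union> pinv g ` {..n}"
  by (induction n) (auto simp: perm_string_0 perm_string_Suc atMost_Suc)

lemma strict_prefix_perm_string_iff:
  "strict_prefix (perm_string g m) (perm_string h n) \<longleftrightarrow> m < n \<and> perm_string h m = perm_string g m"
proof
  assume pre: "strict_prefix (perm_string g m) (perm_string h n)"
  then have "m < n" using prefix_length_less[OF pre] by (simp add: length_perm_string)
  moreover have "take (2 * m + 2) (perm_string h n) = perm_string g m"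
    using pre by (auto simp: strict_prefix_def prefix_def length_perm_string)
  ultimately show "m < n \<and> perm_string h m = perm_string g m"
    using take_perm_string[of m n h] by simp
next
  assume *: "m < n \<and> perm_string h m = perm_string g m"
  then have "prefix (perm_string g m) (perm_string h n)"
    using take_perm_string[of m n h] take_is_prefix[of "2 * m + 2" "perm_string h n"] by simp
  moreover have "length (perm_string g m) \<noteq> length (perm_string h n)"
    using * by (simp add: length_perm_string)
  ultimately show "strict_prefix (perm_string g m) (perm_string h n)"
    by (auto simp: strict_prefix_def)
qed

text \<open>Strings of the tree have length \<open>2 * n + 2\<close>, so one step in the tree is two
  entries: any longer extension passes through its own initial string at level
  \<open>Suc m\<close>.\<close>

lemma imm_succs_perm_tree:
  assumes "g \<in> G"
  shows "imm_succs (perm_tree G) (perm_string g m) =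
    {perm_string h (Suc m) | h. h \<in> G \<and> perm_string h m = perm_string g m}"
proof (intro equalityI subsetI)
  fix \<sigma> assume \<sigma>: "\<sigma> \<in> imm_succs (perm_tree G) (perm_string g m)"
  then obtain h n where h: "h \<in> G" "\<sigma> = perm_string h n"
    by (auto simp: imm_succs_def perm_tree_def)
  then have mn: "m < n" "perm_string h m = perm_string g m"
    using \<sigma> by (auto simp: imm_succs_def strict_prefix_perm_string_iff)
  have "n = Suc m"
  proof (rule ccontr)
    assume "n \<noteq> Suc m"
    with mn have "Suc m < n" by simp
    then have "strict_prefix (perm_string h (Suc m)) \<sigma>"
      using h by (simp add: strict_prefix_perm_string_iff)
    moreover have "strict_prefix (perm_string g m) (perm_string h (Suc m))"
      using mn by (simp add: strict_prefix_perm_string_iff)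
    moreover have "perm_string h (Suc m) \<in> perm_tree G" using h by (auto simp: perm_tree_def)
    ultimately show False using \<sigma> by (auto simp: imm_succs_def)
  qed
  then show "\<sigma> \<in> {perm_string h (Suc m) | h. h \<in> G \<and> perm_string h m = perm_string g m}"
    using h mn by blast
next
  fix \<sigma> assume "\<sigma> \<in> {perm_string h (Suc m) | h. h \<in> G \<and> perm_string h m = perm_string g m}"
  then obtain h where h: "h \<in> G" "\<sigma> = perm_string h (Suc m)" "perm_string h m = perm_string g m"
    by blast
  then show "\<sigma> \<in> imm_succs (perm_tree G) (perm_string g m)"
    by (auto simp: imm_succs_def perm_tree_def strict_prefix_perm_string_iff)
qed

text \<open>The length \<open>2 * m + 2\<close> is written with successors and sums, the operations
  covered by the closure rules.\<close>

definition level_code :: "(nat \<Rightarrow> nat) set \<Rightarrow> nat \<Rightarrow> nat \<Rightarrow> bool" where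
  "level_code G m c \<longleftrightarrow> c \<in> list_encode ` perm_tree G \<and> code_length c = Suc (Suc (m + m))"

text \<open>\<open>Suc k\<close> is the code of the finite value \<open>k\<close> in
  \<open>enat_encode\<close>. Off the tree the first disjunct stops the search at 0.\<close>

definition branching_at :: "(nat \<Rightarrow> nat) set \<Rightarrow> nat \<Rightarrow> nat" where
  "branching_at G c = (LEAST k. c \<notin> list_encode ` perm_tree G \<or>
     prod_encode (c, Suc k) \<in> branching_graph (perm_tree G))"

lemma level_code_iff: "level_code G m c \<longleftrightarrow> (\<exists>g\<in>G. c = list_encode (perm_string g m))"
proof -
  have "c \<in> list_encode ` perm_tree G \<longleftrightarrow> (\<exists>g\<in>G. \<exists>n. c = list_encode (perm_string g n))"
    by (auto simp: perm_tree_def)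
  moreover have "code_length (list_encode (perm_string g n)) = Suc (Suc (m + m)) \<longleftrightarrow> n = m" for g n
    by (auto simp: code_length_list_encode length_perm_string)
  ultimately show ?thesis unfolding level_code_def by metis
qed

lemma tree_oracle_even: "n + n \<in> tree_oracle T \<longleftrightarrow> n \<in> list_encode ` T"
  unfolding tree_oracle_def turing_join_def by (auto simp: mult_2[symmetric]) presburger

lemma tree_oracle_odd: "Suc (n + n) \<in> tree_oracle T \<longleftrightarrow> n \<in> branching_graph T"
  unfolding tree_oracle_def turing_join_def by (auto simp: mult_2[symmetric]) presburger

lemma decidable_tree [rec_intros]:
  assumes "recursive_in (tree_oracle T) f"
  shows "recursive_in (tree_oracle T) (\<lambda>x. of_bool (f x \<in> list_encode ` T))"
proof -
  have "recursive_in (tree_oracle T) (\<lambda>x. of_bool (f x + f x \<in> tree_oracle T))"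
    by (intro rec_intros assms)
  then show ?thesis by (simp add: tree_oracle_even)
qed

lemma decidable_branching_graph [rec_intros]:
  assumes "recursive_in (tree_oracle T) f"
  shows "recursive_in (tree_oracle T) (\<lambda>x. of_bool (f x \<in> branching_graph T))"
proof -
  have "recursive_in (tree_oracle T) (\<lambda>x. of_bool (Suc (f x + f x) \<in> tree_oracle T))"
    by (intro rec_intros assms)
  then show ?thesis by (simp add: tree_oracle_odd)
qed

lemma decidable_level_code [rec_intros]:
  "recursive_in (tree_oracle (perm_tree G)) f \<Longrightarrow> recursive_in (tree_oracle (perm_tree G)) h \<Longrightarrow>
    recursive_in (tree_oracle (perm_tree G)) (\<lambda>x. of_bool (level_code G (f x) (h x)))"
  unfolding level_code_def by (intro rec_intros)

section \<open>Counting the levels by the branching function\<close>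

context finite_orbits
begin

text \<open>Every entry \<open>g i\<close> or \<open>pinv g i\<close> with \<open>i \<le> m\<close>
  lies in the finite orbit of \<open>i\<close>.\<close>

lemma finite_level: "finite {c. level_code G m c}"
proof -
  have "set (perm_string g m) \<subseteq> (\<Union>i\<in>{..m}. orb G i)" if "g \<in> G" for g
    unfolding set_perm_string using that inv_in_G[OF that] by (auto simp: orb_def)
  then have "{c. level_code G m c} \<subseteq>
      list_encode ` {xs. set xs \<subseteq> (\<Union>i\<in>{..m}. orb G i) \<and> length xs = 2 * m + 2}"
    by (auto simp: level_code_iff length_perm_string)
  then show ?thesis
    using finite_lists_length_eq[of "\<Union>i\<in>{..m}. orb G i"] finite_orb
    by (meson finite_UN finite_atMost finite_imageI finite_subset)
qed

lemma imm_succs_subset_level: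
  "g \<in> G \<Longrightarrow> list_encode ` imm_succs (perm_tree G) (perm_string g m) \<subseteq> {c. level_code G (Suc m) c}"
  by (auto simp: imm_succs_perm_tree level_code_iff)

lemma finite_imm_succs: "g \<in> G \<Longrightarrow> finite (imm_succs (perm_tree G) (perm_string g m))"
  using imm_succs_subset_level finite_level by (meson finite_imageD finite_subset inj_list_encode)

lemma branching_at_perm_string:
  assumes "g \<in> G"
  shows "branching_at G (list_encode (perm_string g m)) = card (imm_succs (perm_tree G) (perm_string g m))"
proof -
  have "perm_string g m \<in> perm_tree G" using assms by (auto simp: perm_tree_def)
  then have "list_encode (perm_string g m) \<notin> list_encode ` perm_tree G \<or>
      prod_encode (list_encode (perm_string g m), Suc k) \<in> branching_graph (perm_tree G) \<longleftrightarrow>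
      k = card (imm_succs (perm_tree G) (perm_string g m))" for k
    using finite_imm_succs[OF assms, of m]
    by (auto simp: branching_graph_def branching_def list_encode_eq)
  then show ?thesis unfolding branching_at_def by (simp add: Least_equality)
qed

lemma recursive_branching_at [rec_intros]:
  assumes "recursive_in (tree_oracle (perm_tree G)) f"
  shows "recursive_in (tree_oracle (perm_tree G)) (\<lambda>x. branching_at G (f x))"
proof -
  have "\<exists>k. c \<notin> list_encode ` perm_tree G \<or>
      prod_encode (c, Suc k) \<in> branching_graph (perm_tree G)" for c
  proof (cases "c \<in> list_encode ` perm_tree G")
    case True
    then obtain g m where g: "g \<in> G" "c = list_encode (perm_string g m)"
      by (auto simp: perm_tree_def)
    then have "prod_encode (c, Suc (card (imm_succs (perm_tree G) (perm_string g m))))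
        \<in> branching_graph (perm_tree G)"
      using finite_imm_succs[OF g(1), of m] True
      by (force simp: branching_graph_def branching_def list_encode_eq)
    then show ?thesis by blast
  qed simp
  then have "recursive_in (tree_oracle (perm_tree G)) (\<lambda>c. branching_at G c)"
    unfolding branching_at_def by (intro recursive_Least rec_intros)
  from recursive_in.comp[OF this assms] show ?thesis .
qed

text \<open>A string at level \<open>Suc m\<close> determines its initial string at level
  \<open>m\<close>, so the successor sets partition the next level.\<close>

lemma card_level_Suc:
  "card {c. level_code G (Suc m) c} = (\<Sum>c | level_code G m c. branching_at G c)"
proof -
  define S where "S c = list_encode ` imm_succs (perm_tree G) (list_decode c)" for c
  have S: "S (list_encode (perm_string g m)) =
      {list_encode (perm_string h (Suc m)) | h. h \<in> G \<and> perm_string h m = perm_string g m}"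
    if "g \<in> G" for g
    using imm_succs_perm_tree[OF that, of m] by (auto simp: S_def)
  have "{c. level_code G (Suc m) c} = (\<Union>c\<in>{c. level_code G m c}. S c)"
    using S by (auto simp: level_code_iff)
  moreover have "card (\<Union>c\<in>{c. level_code G m c}. S c) = (\<Sum>c | level_code G m c. card (S c))"
  proof (rule card_UN_disjoint)
    show "\<forall>c\<in>{c. level_code G m c}. finite (S c)"
      using finite_imm_succs by (auto simp: level_code_iff S_def)
    have take: "perm_string h m = perm_string h' m"
      if "perm_string h (Suc m) = perm_string h' (Suc m)" for h h'
      using take_perm_string[of m "Suc m" h] take_perm_string[of m "Suc m" h'] that by simp
    have "c = d" if cd: "level_code G m c" "level_code G m d" and e: "e \<in> S c" "e \<in> S d" for c d e
    proof -
      obtain g g' where g: "g \<in> G" "c = list_encode (perm_string g m)"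
        "g' \<in> G" "d = list_encode (perm_string g' m)"
        using cd by (auto simp: level_code_iff)
      obtain h h' where "e = list_encode (perm_string h (Suc m))" "perm_string h m = perm_string g m"
        "e = list_encode (perm_string h' (Suc m))" "perm_string h' m = perm_string g' m"
        using e S[OF g(1)] S[OF g(3)] unfolding g(2,4) by blast
      then show ?thesis using take[of h h'] g(2,4) by (simp add: list_encode_eq)
    qed
    then show "\<forall>c\<in>{c. level_code G m c}. \<forall>d\<in>{c. level_code G m c}. c \<noteq> d \<longrightarrow> S c \<inter> S d = {}"
      by blast
  qed (rule finite_level)
  moreover have "card (S c) = branching_at G c" if "level_code G m c" for c
    using that by (auto simp: level_code_iff S_def branching_at_perm_string
        card_image[OF inj_list_encode])
  ultimately show ?thesis by simp
qed

text \<open>The branching function tells how many codes the next level has, so an unbounded search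
  for a bound can stop once that many have been seen. The empty string is not in the tree, hence
  the bound for the first level is not computed but hardwired.\<close>

definition level_bound :: "nat \<Rightarrow> nat" where
  "level_bound = rec_nat (SOME b. \<forall>c. level_code G 0 c \<longrightarrow> c < b) (\<lambda>m r. LEAST b.
     (\<Sum>c<r. if level_code G m c then branching_at G c else 0) \<le>
     (\<Sum>c<b. of_bool (level_code G (Suc m) c)))"

lemma finite_level_bounded: "\<exists>b. \<forall>c. level_code G m c \<longrightarrow> c < b"
  using finite_level[of m] finite_nat_set_iff_bounded by auto

lemma sum_level_code_less: "(\<Sum>c<b. of_bool (level_code G m c)) = card ({c. level_code G m c} \<inter> {..<b})"
  by (simp add: of_bool_def sum.If_cases Int_commute)

text \<open>Minimisation must succeed for every \<open>r\<close>, not only for a correct bound. A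
  sum over part of the level never exceeds the size of the next level, which the count on the right
  eventually reaches.\<close>

lemma ex_level_bound:
  "\<exists>b. (\<Sum>c<r. if level_code G m c then branching_at G c else 0) \<le>
     (\<Sum>c<b. of_bool (level_code G (Suc m) c))"
proof -
  obtain b where b: "\<forall>c. level_code G (Suc m) c \<longrightarrow> c < b" using finite_level_bounded by blast
  then have "{c. level_code G (Suc m) c} \<inter> {..<b} = {c. level_code G (Suc m) c}" by auto
  then have "(\<Sum>c<b. of_bool (level_code G (Suc m) c)) = (\<Sum>c | level_code G m c. branching_at G c)"
    by (simp only: sum_level_code_less card_level_Suc)
  moreover have "(\<Sum>c<r. if level_code G m c then branching_at G c else 0) =
      (\<Sum>c\<in>{c. level_code G m c} \<inter> {..<r}. branching_at G c)"
    by (simp add: sum.If_cases Int_commute)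
  moreover have "\<dots> \<le> (\<Sum>c | level_code G m c. branching_at G c)"
    by (intro sum_mono2 finite_level) auto
  ultimately show ?thesis by metis
qed

text \<open>If as many codes of a finite level lie below a bound as the level has altogether, then
  all of them lie below it.\<close>

lemma level_code_less_bound: "level_code G m c \<Longrightarrow> c < level_bound m"
proof (induction m arbitrary: c)
  case 0
  then show ?case using someI_ex[OF finite_level_bounded] by (simp add: level_bound_def)
next
  case (Suc m)
  have "{c. level_code G m c} \<inter> {..<level_bound m} = {c. level_code G m c}"
    using Suc.IH by auto
  then have "(\<Sum>c<level_bound m. if level_code G m c then branching_at G c else 0) =
      card {c. level_code G (Suc m) c}"
    by (simp add: sum.If_cases Int_commute card_level_Suc)
  moreover have "(\<Sum>c<level_bound m. if level_code G m c then branching_at G c else 0) \<le>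
      (\<Sum>c<level_bound (Suc m). of_bool (level_code G (Suc m) c))"
    using LeastI_ex[OF ex_level_bound] by (simp add: level_bound_def)
  ultimately have "card {c. level_code G (Suc m) c} \<le>
      card ({c. level_code G (Suc m) c} \<inter> {..<level_bound (Suc m)})"
    by (simp only: sum_level_code_less)
  then have "{c. level_code G (Suc m) c} \<inter> {..<level_bound (Suc m)} = {c. level_code G (Suc m) c}"
    using finite_level by (intro card_seteq) auto
  with Suc.prems show ?case by auto
qed

lemma recursive_level_bound [rec_intros]:
  assumes "recursive_in (tree_oracle (perm_tree G)) f"
  shows "recursive_in (tree_oracle (perm_tree G)) (\<lambda>x. level_bound (f x))"
  unfolding level_bound_def
  by (intro rec_intros assms recursive_Least ex_level_bound)

section \<open>Orbits and agreement on an orbit, read off the tree\<close>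

lemma less_level_bound: "y \<in> orb G x \<Longrightarrow> y < level_bound x"
proof -
  assume "y \<in> orb G x"
  then obtain g where g: "g \<in> G" "y = g x" by (auto simp: orb_def)
  then have "y < list_encode (perm_string g x)"
    using nth_less_list_encode[of "2 * x" "perm_string g x"]
    by (simp add: perm_string_nth length_perm_string)
  also have "\<dots> < level_bound x" using g by (intro level_code_less_bound) (auto simp: level_code_iff)
  finally show ?thesis .
qed

lemma code_nth_perm_string: "y \<le> n \<Longrightarrow> code_nth (list_encode (perm_string g n)) (y + y) = g y"
  using perm_string_nth[of y n g] by (simp add: code_nth_list_encode length_perm_string mult_2)

lemma orb_iff_level_code:
  "y \<in> orb G x \<longleftrightarrow> (\<exists>c<level_bound x. level_code G x c \<and> code_nth c (x + x) = y)"
proof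
  assume "y \<in> orb G x"
  then obtain g where g: "g \<in> G" "y = g x" by (auto simp: orb_def)
  then have "level_code G x (list_encode (perm_string g x))" by (auto simp: level_code_iff)
  then show "\<exists>c<level_bound x. level_code G x c \<and> code_nth c (x + x) = y"
    using g level_code_less_bound code_nth_perm_string by blast
next
  assume "\<exists>c<level_bound x. level_code G x c \<and> code_nth c (x + x) = y"
  then show "y \<in> orb G x"
    by (auto simp: level_code_iff orb_def code_nth_perm_string)
qed

text \<open>Level \<open>level_bound x\<close> records values at all points up to
  \<open>level_bound x\<close>, hence on the whole orbit of \<open>x\<close>, so one string of that
  level shows a candidate \<open>g\<close> there. The inner search over \<open>d\<close> is the
  decidable form of \<open>y \<in> orb G x\<close>.\<close>

definition agrees_on_orbit :: "nat \<Rightarrow> nat \<Rightarrow> nat \<Rightarrow> bool" where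
  "agrees_on_orbit w v x \<longleftrightarrow> (\<exists>c<level_bound (level_bound x). level_code G (level_bound x) c \<and>
     (\<forall>y<level_bound x. (\<exists>d<level_bound x. level_code G x d \<and> code_nth d (x + x) = y) \<longrightarrow>
       assignment w v y = code_nth c (y + y)))"

lemma agrees_on_orbit_iff:
  "agrees_on_orbit w v x \<longleftrightarrow> (\<exists>g\<in>G. \<forall>y\<in>orb G x. assignment w v y = g y)"
proof -
  have "agrees_on_orbit w v x \<longleftrightarrow> (\<exists>c. level_code G (level_bound x) c \<and>
      (\<forall>y\<in>orb G x. assignment w v y = code_nth c (y + y)))"
    unfolding agrees_on_orbit_def orb_iff_level_code[symmetric]
    using level_code_less_bound less_level_bound by blast
  also have "\<dots> \<longleftrightarrow> (\<exists>g\<in>G. \<forall>y\<in>orb G x. assignment w v y = g y)"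
  proof -
    have "code_nth (list_encode (perm_string g (level_bound x))) (y + y) = g y" if "y \<in> orb G x" for g y
      using that by (intro code_nth_perm_string less_imp_le less_level_bound)
    then show ?thesis by (auto simp: level_code_iff)
  qed
  finally show ?thesis .
qed

lemma decidable_agrees_on_orbit [rec_intros]:
  assumes "recursive_in (tree_oracle (perm_tree G)) f" "recursive_in (tree_oracle (perm_tree G)) h"
    "recursive_in (tree_oracle (perm_tree G)) k"
  shows "recursive_in (tree_oracle (perm_tree G)) (\<lambda>x. of_bool (agrees_on_orbit (f x) (h x) (k x)))"
proof -
  have "recursive_in (tree_oracle (perm_tree G))
      (\<lambda>z. of_bool (agrees_on_orbit (pfst z) (pfst (psnd z)) (psnd (psnd z))))"
    unfolding agrees_on_orbit_def by (intro rec_intros)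
  from recursive_in.comp[OF this, of "\<lambda>x. prod_encode (f x, prod_encode (h x, k x))"]
  show ?thesis using assms by (simp add: recursive_in.pair)
qed

text \<open>Only orbits meeting the points below \<open>pfst w\<close> need checking, and the check
  at any such point covers its whole orbit. All else is the identity.\<close>

lemma assignment_orbitwise:
  assumes "\<forall>v<pfst (psnd w). \<forall>x<pfst w. agrees_on_orbit w v x"
  shows "assignment w v \<in> orbitwise G"
proof -
  have "\<exists>g\<in>G. \<forall>y\<in>orb G x. assignment w v y = g y" for x
  proof (cases "v < pfst (psnd w) \<and> (\<exists>y\<in>orb G x. y < pfst w)")
    case True
    then obtain y where "y \<in> orb G x" "y < pfst w" by blast
    then show ?thesis using True assms orb_eq[of y x] agrees_on_orbit_iff[of w v y] by auto
  next
    case False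
    then have "\<forall>y\<in>orb G x. assignment w v y = id y" by (auto simp: assignment_def)
    then show ?thesis using id_in_G by blast
  qed
  then show ?thesis by (simp add: orbitwise_def)
qed

section \<open>Coded witnesses and the existential definition of the theory\<close>

lemma ex_assignment:
  assumes s: "range s \<subseteq> orbitwise G" "perm_sat s \<phi>"
  obtains w where "\<And>v. assignment w v \<in> orbitwise G" "perm_sat (assignment w) \<phi>"
proof -
  obtain s' M where s': "range s' \<subseteq> orbitwise G" "\<And>v x. x \<ge> M \<Longrightarrow> s' v x = x" "perm_sat s' \<phi>"
    using perm_sat_finite_support[OF s] by blast
  obtain K where K: "\<And>s s'. (\<And>v. v < K \<Longrightarrow> s v = s' v) \<Longrightarrow> perm_sat s \<phi> \<longleftrightarrow> perm_sat s' \<phi>"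
    using perm_sat_finite_dependence by blast
  define w where "w = prod_encode (M, prod_encode (K,
    list_encode (map (\<lambda>v. list_encode (map (s' v) [0..<M])) [0..<K])))"
  \<comment> \<open>Cutting at \<open>M\<close> loses nothing, as \<open>s'\<close> is the identity
    from there on; cutting at \<open>K\<close> may change the assignment, but not the truth of
    \<open>\<phi>\<close>.\<close>
  have w: "assignment w v = (if v < K then s' v else id)" for v
    using s'(2) by (auto simp: assignment_def w_def code_nth_list_encode fun_eq_iff)
  show ?thesis
  proof
    show "assignment w v \<in> orbitwise G" for v
      using s'(1) id_orbitwise by (auto simp: w)
    show "perm_sat (assignment w) \<phi>"
      using K[of "assignment w" s'] s'(3) by (simp add: w)
  qed
qed

lemma Sigma01_existential_theory:
  assumes "orbit_independent G"
  shows "Sigma01_in (tree_oracle (perm_tree G)) (form_encode ` existential_theory (perm_group G))"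
proof -
  define P where "P n w \<longleftrightarrow> form_kind n \<noteq> 0 \<and> (\<forall>v<Suc n. occurs_free v n \<noteq> 1) \<and>
    (\<forall>v<pfst (psnd w). \<forall>x<pfst w. agrees_on_orbit w v x) \<and> matrix_holds w n = 1" for n w
  have "recursive_in (tree_oracle (perm_tree G)) (\<lambda>z. of_bool (P (pfst z) (psnd z)))"
    unfolding P_def by (intro rec_intros)
  then have "{z. P (pfst z) (psnd z)} \<le>\<^sub>T tree_oracle (perm_tree G)"
    by (simp add: turing_reducible_def)
  moreover have "form_encode ` existential_theory (perm_group G) = {n. \<exists>w. P n w}"
  proof (intro equalityI subsetI)
    fix n assume "n \<in> form_encode ` existential_theory (perm_group G)"
    then obtain \<phi> where \<phi>: "n = form_encode \<phi>" "existential \<phi>" "free_vars \<phi> = {}"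
      "true_in (perm_group G) \<phi>" by (auto simp: existential_theory_def)
    then obtain w where w: "\<And>v. assignment w v \<in> orbitwise G" "perm_sat (assignment w) \<phi>"
      using true_in_iff_perm_sat[OF assms \<phi>(2,3)] ex_assignment by blast
    have "agrees_on_orbit w v x" for v x
      unfolding agrees_on_orbit_iff using orbitwiseE[OF w(1)] by metis
    moreover have "matrix_holds w n = 1"
      using matrix_holds_encode[OF bij_orbitwise[OF w(1)]] w(2) \<phi>(1) by simp
    moreover have "form_kind n \<noteq> 0" using \<phi>(1,2) by (simp add: form_kind_form_encode)
    ultimately show "n \<in> {n. \<exists>w. P n w}"
      using \<phi>(1,3) closed_iff_occurs_free[of \<phi>] by (auto simp: P_def)
  next
    fix n assume "n \<in> {n. \<exists>w. P n w}"
    then obtain w where w: "P n w" by blast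
    then obtain \<phi> where \<phi>: "n = form_encode \<phi>" using form_kind_imp_code by (auto simp: P_def)
    have ex: "existential \<phi>" using w \<phi> existential.intros(1)
      by (auto simp: P_def form_kind_form_encode split: if_splits)
    have closed: "free_vars \<phi> = {}" using w \<phi> closed_iff_occurs_free by (simp add: P_def)
    \<comment> \<open>The orbit check has to come first: it makes the assignment bijective, which is
      what guarantees that \<open>matrix_holds\<close> computes the truth value.\<close>
    have aw: "assignment w v \<in> orbitwise G" for v
      using w by (intro assignment_orbitwise) (simp add: P_def)
    have "perm_sat (assignment w) \<phi>"
      using matrix_holds_encode[OF bij_orbitwise[OF aw], of \<phi>] w \<phi> by (simp add: P_def)
    then have "true_in (perm_group G) \<phi>"
      unfolding true_in_iff_perm_sat[OF assms ex closed] using aw by (intro exI[of _ "assignment w"]) auto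
    then show "n \<in> form_encode ` existential_theory (perm_group G)"
      using ex closed \<phi> by (simp add: existential_theory_def)
  qed
  ultimately show ?thesis
    unfolding Sigma01_in_def by (intro exI[of _ "{z. P (pfst z) (psnd z)}"]) simp
qed

end

theorem theorem1:
  fixes G :: "(nat \<Rightarrow> nat) set"
  assumes "profinite_subgroup G" and "orbit_independent G"
  shows "Sigma01_in (tree_oracle (perm_tree G)) (form_encode ` existential_theory (perm_group G))"
proof -
  interpret finite_orbits G
    using assms(1) by (auto simp: profinite_subgroup_def intro: finite_orbits.intro)
  show ?thesis by (rule Sigma01_existential_theory[OF assms(2)])
qed

end
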